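(* Let $K$ be a complete multicomplex, and let $\Delta_0$ be an $n$-simplex of $K$, $n\geq 1$. Fix an ordering on the vertices of $\Delta_0$ and denote by $x_0$ the minimal vertex of $\Delta_0$. Let $\pi(\Delta_0)$ be the set of $n$-simplices of $K$ compatible with $\Delta_0$. Then the map $$\Theta\colon\pi(\Delta_0)\to\pi_n(|K|,x_0),\qquad \Theta(\Delta)=\left[\dot{S}^n(\Delta_0,\Delta)\right]$$ is surjective, and $\Theta(\Delta)=\Theta(\Delta')$ if and only if $\Delta$ is homotopic to $\Delta'$.
   Context: **Multicomplexes.** A multicomplex is a triple $K=(V,I,\Omega)$, where $V$ is a set (the vertices), $I=\bigcup_A I_A$ with $A$ ranging over the finite subsets of $V$, each $I_A$ is a (possibly empty) set (the simplices with vertex set $A$), $I_A$ is a singleton when $A$ is a singleton, and $\Omega$ is a family of maps $\partial_{A,B}\colon I_A\to I_B$ (for $A\supseteq B$) such that $\partial_{A,A}=\mathrm{Id}$ and $\partial_{B,C}\circ\partial_{A,B}=\partial_{A,C}$ for $A\supseteq B\supseteq C$. A simplex in $I_A$ has dimension $|A|-1$. A simplicial map $K\to K'$ consists of a map $f\colon V\to V'$ and maps $f_A\colon I_A\to I'_{f(A)}$ commuting with the boundary maps; it is a simplicial embedding if $f$ and all the $f_A$ are injective. The geometric realization $|K|$ is the CW complex obtained by taking one affine simplex with vertex set $A$ for every $\sigma\in I_A$ and gluing the face spanned by $B\subseteq A$ to the simplex corresponding to $\partial_{A,B}\sigma$ via the affine map that is the identity on $B$, with the weak topology; $|\sigma|\subseteq|K|$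 denotes the closed cell of $\sigma$. Simplicial maps induce continuous maps on geometric realizations; the standard simplex $\Delta^n$ and its boundary are regarded as multicomplexes. **Complete.** $K$ is complete if every continuous map $f\colon|\Delta^n|\to|K|$ ($n\geq 1$) whose restriction to $\partial|\Delta^n|$ is (induced by) a simplicial embedding is homotopic relative to $\partial|\Delta^n|$ to (the realization of) a simplicial embedding $\Delta^n\to K$. **Compatible and homotopic simplices.** Two $n$-simplices $\Delta_1,\Delta_2$ of $K$ are compatible if they have the same vertex set and $\partial_B\Delta_1=\partial_B\Delta_2$ for every proper subset $B$ of this vertex set (equivalently, $\partial|\Delta_1|=\partial|\Delta_2|$ in $|K|$). They are homotopic if they are compatible and, given characteristic maps (affine parametrizations) $i_j\colon|\Delta^n|\to|\Delta_j|$ with $i_1=i_2$ on $\partial|\Delta^n|$, the maps $i_1,i_2\colon |\Delta^n|\to|K|$ are homotopic relative to $\partial|\Delta^n|$. **Special spheres.** The special sphere $\dot{S}^n$ is the multicomplex with an ordered set of $n+1$ vertices $s_0<\dots<s_n$, exactly two $n$-simplices $\Delta^n_n$ (northern) and $\Delta^n_s$ (southern), and exactly one simplex for each non-empty proper subset of the set of vertices. Thus $|\dot{S}^n|\cong S^n$ is two $n$-simplices glued along their boundary; a pointed homeomorphism $(S^n,* )\cong(|\dot{S}^n|,s_0)$ is fixed once and for all. Given compatible $n$-simplices $\Delta_1,\Delta_2$ of $K$ with an ordering $x_0<\dots<x_n$ of their common vertices, $\dot{S}^n(\Delta_1,\Delta_2)\colon(\dot{S}^n,s_0)\to(K,x_0)$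 is the unique simplicial map that is order-preserving (and bijective onto $\{x_0,\dots,x_n\}$) on vertices and sends $\Delta^n_s$ to $\Delta_1$ and $\Delta^n_n$ to $\Delta_2$. Its realization defines a class $[\dot{S}^n(\Delta_1,\Delta_2)]\in\pi_n(|K|,x_0)$. *)

theory Defs
  imports "HOL-Analysis.Analysis"
begin

section \<open>Multicomplexes and simplicial maps\<close>

text \<open>
  A simplex is identified with the pair of its vertex set \<open>A\<close> and an element of \<open>mc_simps K A\<close>,
  so the sets \<open>mc_simps K A\<close> need not be disjoint for different \<open>A\<close>.
  \<open>mc_bdry K A B\<close> is the map from the simplices over \<open>A\<close> to those over \<open>B\<close>; only its values for
  nonempty \<open>B \<subseteq> A\<close> on \<open>mc_simps K A\<close> matter.
\<close>

record ('v, 's) multicomplex_data =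
  mc_verts :: "'v set"
  mc_simps :: "'v set \<Rightarrow> 's set"
  mc_bdry :: "'v set \<Rightarrow> 'v set \<Rightarrow> 's \<Rightarrow> 's"

locale multicomplex =
  fixes K :: "('v, 's) multicomplex_data"
  assumes simps_over:
      "\<And>A. mc_simps K A \<noteq> {} \<Longrightarrow> finite A \<and> A \<noteq> {} \<and> A \<subseteq> mc_verts K"
    and simps_vertex: "\<And>v. v \<in> mc_verts K \<Longrightarrow> \<exists>s. mc_simps K {v} = {s}"
    and bdry_closed:
      "\<And>A B \<sigma>. \<sigma> \<in> mc_simps K A \<Longrightarrow> B \<subseteq> A \<Longrightarrow> B \<noteq> {} \<Longrightarrow> mc_bdry K A B \<sigma> \<in> mc_simps K B"
    and bdry_id: "\<And>A \<sigma>. \<sigma> \<in> mc_simps K A \<Longrightarrow> mc_bdry K A A \<sigma> = \<sigma>"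
    and bdry_comp:
      "\<And>A B C \<sigma>. \<sigma> \<in> mc_simps K A \<Longrightarrow> B \<subseteq> A \<Longrightarrow> C \<subseteq> B \<Longrightarrow> C \<noteq> {} \<Longrightarrow>
         mc_bdry K B C (mc_bdry K A B \<sigma>) = mc_bdry K A C \<sigma>"

definition n_simplices :: "('v, 's) multicomplex_data \<Rightarrow> nat \<Rightarrow> ('v set \<times> 's) set" where
  "n_simplices K n = {(A, \<sigma>). \<sigma> \<in> mc_simps K A \<and> card A = n + 1}"

definition simplicial_map ::
  "('v, 's) multicomplex_data \<Rightarrow> ('w, 't) multicomplex_data \<Rightarrow> ('v \<Rightarrow> 'w) \<Rightarrow> ('v set \<Rightarrow> 's \<Rightarrow> 't) \<Rightarrow> bool"
  where
  "simplicial_map K L f F \<longleftrightarrow>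
     f ` mc_verts K \<subseteq> mc_verts L \<and>
     (\<forall>A. \<forall>\<sigma>\<in>mc_simps K A. F A \<sigma> \<in> mc_simps L (f ` A)) \<and>
     (\<forall>A. \<forall>\<sigma>\<in>mc_simps K A. \<forall>B. B \<subseteq> A \<longrightarrow> B \<noteq> {} \<longrightarrow>
        mc_bdry L (f ` A) (f ` B) (F A \<sigma>) = F B (mc_bdry K A B \<sigma>))"

definition simplicial_embedding ::
  "('v, 's) multicomplex_data \<Rightarrow> ('w, 't) multicomplex_data \<Rightarrow> ('v \<Rightarrow> 'w) \<Rightarrow> ('v set \<Rightarrow> 's \<Rightarrow> 't) \<Rightarrow> bool"
  where
  "simplicial_embedding K L f F \<longleftrightarrow>
     simplicial_map K L f F \<and> inj_on f (mc_verts K) \<and> (\<forall>A. inj_on (F A) (mc_simps K A))"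


section \<open>Geometric realization\<close>

definition quotient_topology :: "'a topology \<Rightarrow> ('a \<Rightarrow> 'b) \<Rightarrow> 'b topology" where
  "quotient_topology X q =
     topology (\<lambda>U. U \<subseteq> q ` topspace X \<and> openin X {x \<in> topspace X. q x \<in> U})"

lemma openin_quotient_topology:
  "openin (quotient_topology X q) U \<longleftrightarrow>
     U \<subseteq> q ` topspace X \<and> openin X {x \<in> topspace X. q x \<in> U}"
proof -
  have "istopology (\<lambda>U. U \<subseteq> q ` topspace X \<and> openin X {x \<in> topspace X. q x \<in> U})"
    unfolding istopology_def
  proof (intro conjI allI impI)
    fix S T
    assume "S \<subseteq> q ` topspace X \<and> openin X {x \<in> topspace X. q x \<in> S}"
      "T \<subseteq> q ` topspace X \<and> openin X {x \<in> topspace X. q x \<in> T}"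
    moreover have "{x \<in> topspace X. q x \<in> S \<inter> T} =
        {x \<in> topspace X. q x \<in> S} \<inter> {x \<in> topspace X. q x \<in> T}"
      by auto
    ultimately show "S \<inter> T \<subseteq> q ` topspace X" "openin X {x \<in> topspace X. q x \<in> S \<inter> T}"
      by auto
  next
    fix \<K>
    assume *: "\<forall>S\<in>\<K>. S \<subseteq> q ` topspace X \<and> openin X {x \<in> topspace X. q x \<in> S}"
    then show "\<Union>\<K> \<subseteq> q ` topspace X" by auto
    have "{x \<in> topspace X. q x \<in> \<Union>\<K>} = (\<Union>S\<in>\<K>. {x \<in> topspace X. q x \<in> S})"
      by auto
    then show "openin X {x \<in> topspace X. q x \<in> \<Union>\<K>}"
      using * by auto
  qed
  then show ?thesis
    by (simp add: quotient_topology_def topology_inverse')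
qed

lemma topspace_quotient_topology [simp]: "topspace (quotient_topology X q) = q ` topspace X"
proof -
  have "openin (quotient_topology X q) (q ` topspace X)"
    unfolding openin_quotient_topology
    using openin_topspace[of X] by (simp add: image_eqI[OF refl] cong: conj_cong)
  then show ?thesis
    using openin_quotient_topology[of X q "topspace (quotient_topology X q)"]
    by (simp add: openin_subset subset_antisym)
qed

lemma quotient_map_quotient_topology: "quotient_map X (quotient_topology X q) q"
  by (auto simp: quotient_map_def openin_quotient_topology)

definition barycentric :: "'v set \<Rightarrow> ('v \<Rightarrow> real) set" where
  "barycentric A = {x. (\<forall>v. 0 \<le> x v) \<and> (\<forall>v. v \<notin> A \<longrightarrow> x v = 0) \<and> sum x A = 1}"

definition cell_sum :: "('v, 's) multicomplex_data \<Rightarrow> (('v set \<times> 's) \<times> ('v \<Rightarrow> real)) topology" where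
  "cell_sum K =
     sum_topology (\<lambda>(A, \<sigma>). subtopology (powertop_real UNIV) (barycentric A))
       {(A, \<sigma>). \<sigma> \<in> mc_simps K A}"

definition gluing :: "('v, 's) multicomplex_data \<Rightarrow> (('v set \<times> 's) \<times> ('v \<Rightarrow> real)) rel" where
  "gluing K = {(((A, \<sigma>), x), ((B, mc_bdry K A B \<sigma>), x)) |A B \<sigma> x.
     \<sigma> \<in> mc_simps K A \<and> B \<subseteq> A \<and> B \<noteq> {} \<and> x \<in> barycentric B}"

type_synonym ('v, 's) mc_point = "(('v set \<times> 's) \<times> ('v \<Rightarrow> real)) set"

text \<open>A point of the realization is a class of the equivalence relation generated by the gluing;
  \<open>cell_pt K A \<sigma>\<close> is the tautological map of the affine simplex on \<open>A\<close> onto the closed cell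
  of \<open>\<sigma>\<close>.\<close>

definition glue_class ::
  "('v, 's) multicomplex_data \<Rightarrow> (('v set \<times> 's) \<times> ('v \<Rightarrow> real)) \<Rightarrow> ('v, 's) mc_point" where
  "glue_class K p = (gluing K \<union> (gluing K)\<inverse>)\<^sup>* `` {p}"

definition cell_pt :: "('v, 's) multicomplex_data \<Rightarrow> 'v set \<Rightarrow> 's \<Rightarrow> ('v \<Rightarrow> real) \<Rightarrow> ('v, 's) mc_point" where
  "cell_pt K A \<sigma> x = glue_class K ((A, \<sigma>), x)"

definition realization :: "('v, 's) multicomplex_data \<Rightarrow> ('v, 's) mc_point topology" where
  "realization K = quotient_topology (cell_sum K) (glue_class K)"

definition vertex_pt :: "('v, 's) multicomplex_data \<Rightarrow> 'v \<Rightarrow> ('v, 's) mc_point" where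
  "vertex_pt K v = cell_pt K {v} (the_elem (mc_simps K {v})) (\<lambda>w. if w = v then 1 else 0)"

text \<open>The affine extension of a map \<open>f\<close> of vertices, in barycentric coordinates.\<close>

definition affine_ext :: "('v \<Rightarrow> 'w) \<Rightarrow> 'v set \<Rightarrow> ('v \<Rightarrow> real) \<Rightarrow> ('w \<Rightarrow> real)" where
  "affine_ext f A x = (\<lambda>w. \<Sum>v\<in>{v \<in> A. f v = w}. x v)"

definition realize_map ::
  "('v, 's) multicomplex_data \<Rightarrow> ('w, 't) multicomplex_data \<Rightarrow> ('v \<Rightarrow> 'w) \<Rightarrow> ('v set \<Rightarrow> 's \<Rightarrow> 't) \<Rightarrow>
     ('v, 's) mc_point \<Rightarrow> ('w, 't) mc_point" where
  "realize_map K L f F c =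
     the_elem ((\<lambda>((A, \<sigma>), x). cell_pt L (f ` A) (F A \<sigma>) (affine_ext f A x)) ` c)"

lemma topspace_cell_sum:
  "topspace (cell_sum K) = {((A, \<sigma>), x). \<sigma> \<in> mc_simps K A \<and> x \<in> barycentric A}"
  by (auto simp: cell_sum_def topspace_sum_topology)

lemma topspace_realization:
  "topspace (realization K) = {cell_pt K A \<sigma> x |A \<sigma> x. \<sigma> \<in> mc_simps K A \<and> x \<in> barycentric A}"
  by (force simp: realization_def topspace_cell_sum cell_pt_def)

lemma glue_class_self: "p \<in> glue_class K p"
  by (simp add: glue_class_def)

lemma glue_class_eq: "(p, q) \<in> gluing K \<Longrightarrow> glue_class K p = glue_class K q"
proof -
  assume "(p, q) \<in> gluing K"
  then have "(p, q) \<in> (gluing K \<union> (gluing K)\<inverse>)\<^sup>*" "(q, p) \<in> (gluing K \<union> (gluing K)\<inverse>)\<^sup>*"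
    by auto
  then show ?thesis
    unfolding glue_class_def by (auto intro: rtrancl_trans)
qed

lemma cell_pt_face:
  assumes "\<sigma> \<in> mc_simps K A" "B \<subseteq> A" "B \<noteq> {}" "x \<in> barycentric B"
  shows "cell_pt K A \<sigma> x = cell_pt K B (mc_bdry K A B \<sigma>) x"
  unfolding cell_pt_def using assms by (intro glue_class_eq) (auto simp: gluing_def)

lemma affine_ext_barycentric:
  assumes "finite A" "x \<in> barycentric A"
  shows "affine_ext f A x \<in> barycentric (f ` A)"
proof -
  have "(\<Sum>w\<in>f ` A. affine_ext f A x w) = sum x A"
    unfolding affine_ext_def
    by (rule sum.group[OF assms(1) finite_imageI[OF assms(1)] subset_refl])
  moreover have "affine_ext f A x w = 0" if "w \<notin> f ` A" for w
    unfolding affine_ext_def by (rule sum.neutral) (use that in auto)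
  moreover have "0 \<le> affine_ext f A x w" for w
    unfolding affine_ext_def by (rule sum_nonneg) (use assms(2) in \<open>auto simp: barycentric_def\<close>)
  ultimately show ?thesis
    using assms(2) by (simp add: barycentric_def)
qed

lemma affine_ext_face:
  assumes "finite A" "B \<subseteq> A" "x \<in> barycentric B"
  shows "affine_ext f A x = affine_ext f B x"
  unfolding affine_ext_def
  by (rule ext, rule sum.mono_neutral_right) (use assms in \<open>auto simp: barycentric_def\<close>)

lemma realize_map_cell_pt:
  assumes K: "multicomplex K" and f: "simplicial_map K L f F"
    and \<sigma>: "\<sigma> \<in> mc_simps K A" and x: "x \<in> barycentric A"
  shows "realize_map K L f F (cell_pt K A \<sigma> x) =
           cell_pt L (f ` A) (F A \<sigma>) (affine_ext f A x)"
proof -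
  let ?h = "\<lambda>((A, \<sigma>), x). cell_pt L (f ` A) (F A \<sigma>) (affine_ext f A x)"
  have glue: "?h p = ?h q" if pq: "(p, q) \<in> gluing K" for p q
  proof -
    from pq obtain A B \<sigma> x where *: "p = ((A, \<sigma>), x)" "q = ((B, mc_bdry K A B \<sigma>), x)"
      "\<sigma> \<in> mc_simps K A" "B \<subseteq> A" "B \<noteq> {}" "x \<in> barycentric B"
      by (auto simp: gluing_def)
    have fin: "finite A" "finite B"
      using multicomplex.simps_over[OF K, of A] *(3,4) by (auto intro: finite_subset)
    have b: "mc_bdry L (f ` A) (f ` B) (F A \<sigma>) = F B (mc_bdry K A B \<sigma>)"
      and m: "F A \<sigma> \<in> mc_simps L (f ` A)"
      using f *(3-5) by (auto simp: simplicial_map_def)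
    have "cell_pt L (f ` A) (F A \<sigma>) (affine_ext f B x) =
        cell_pt L (f ` B) (F B (mc_bdry K A B \<sigma>)) (affine_ext f B x)"
      unfolding b[symmetric]
      by (rule cell_pt_face[OF m image_mono[OF *(4)] _ affine_ext_barycentric[OF fin(2) *(6)]])
        (simp add: *(5))
    then show ?thesis
      by (simp only: *(1,2) prod.case affine_ext_face[OF fin(1) *(4,6)])
  qed
  have "?h q = ?h ((A, \<sigma>), x)" if "q \<in> cell_pt K A \<sigma> x" for q
  proof -
    from that have "(((A, \<sigma>), x), q) \<in> (gluing K \<union> (gluing K)\<inverse>)\<^sup>*"
      by (simp add: cell_pt_def glue_class_def)
    then show ?thesis
    proof (induction rule: rtrancl_induct)
      case (step p q)
      from step.hyps(2) have "?h p = ?h q"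
        by (elim UnE converseE) (simp_all only: prod.inject glue)
      with step.IH show ?case by (simp only:)
    qed (rule refl)
  qed
  moreover have "((A, \<sigma>), x) \<in> cell_pt K A \<sigma> x"
    by (simp add: cell_pt_def glue_class_self)
  ultimately have "?h ` cell_pt K A \<sigma> x = {?h ((A, \<sigma>), x)}"
    by blast
  then show ?thesis
    by (simp add: realize_map_def)
qed

lemma sum_topology_continuous:
  assumes "\<And>i. i \<in> I \<Longrightarrow> continuous_map (X i) Y (h \<circ> (\<lambda>x. (i, x)))"
  shows "continuous_map (sum_topology X I) Y h"
  unfolding continuous_map_def
proof (intro conjI allI impI)
  show "h \<in> topspace (sum_topology X I) \<rightarrow> topspace Y"
    using assms by (fastforce simp: topspace_sum_topology continuous_map_def)
  fix U assume U: "openin Y U"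
  have "openin (X i) {x. (i, x) \<in> {p \<in> topspace (sum_topology X I). h p \<in> U}}" if "i \<in> I" for i
    using openin_continuous_map_preimage[OF assms[OF that] U] that
    by (simp add: topspace_sum_topology)
  then show "openin (sum_topology X I) {p \<in> topspace (sum_topology X I). h p \<in> U}"
    by (auto simp: openin_sum_topology topspace_sum_topology)
qed

lemma continuous_map_realize_map:
  assumes K: "multicomplex K" and f: "simplicial_map K L f F"
  shows "continuous_map (realization K) (realization L) (realize_map K L f F)"
proof -
  let ?B = "\<lambda>A. subtopology (powertop_real UNIV) (barycentric A)"
  let ?h = "realize_map K L f F \<circ> glue_class K"
  have cell_cont: "continuous_map (?B A) (realization L) (cell_pt L A \<sigma>)"
    if \<sigma>: "\<sigma> \<in> mc_simps L A" for A \<sigma>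
  proof -
    have "continuous_map (?B A) (cell_sum L) (\<lambda>x. ((A, \<sigma>), x))"
      using continuous_map_component_injection[of "(A, \<sigma>)" "{(A, \<sigma>). \<sigma> \<in> mc_simps L A}"
          "\<lambda>(A, \<sigma>). ?B A"] \<sigma>
      by (simp add: cell_sum_def)
    moreover have "continuous_map (cell_sum L) (realization L) (glue_class L)"
      unfolding realization_def
      by (rule quotient_imp_continuous_map[OF quotient_map_quotient_topology])
    ultimately have "continuous_map (?B A) (realization L) (glue_class L \<circ> (\<lambda>x. ((A, \<sigma>), x)))"
      by (rule continuous_map_compose)
    then show ?thesis by (simp add: o_def cell_pt_def[abs_def])
  qed
  have "continuous_map (cell_sum K) (realization L) ?h"
    unfolding cell_sum_def
  proof (rule sum_topology_continuous, clarsimp)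
    fix A \<sigma> assume \<sigma>: "\<sigma> \<in> mc_simps K A"
    have fin: "finite A" using multicomplex.simps_over[OF K, of A] \<sigma> by auto
    have m: "F A \<sigma> \<in> mc_simps L (f ` A)" using f \<sigma> by (auto simp: simplicial_map_def)
    have "continuous_map (?B A) (powertop_real UNIV) (affine_ext f A)"
      unfolding continuous_map_componentwise_UNIV affine_ext_def
      by (intro allI continuous_map_sum continuous_map_from_subtopology
          continuous_map_product_projection) (use fin in auto)
    then have "continuous_map (?B A) (?B (f ` A)) (affine_ext f A)"
      using affine_ext_barycentric[OF fin, of _ f]
      by (auto simp: continuous_map_in_subtopology)
    from continuous_map_compose[OF this cell_cont[OF m]]
    have "continuous_map (?B A) (realization L) (cell_pt L (f ` A) (F A \<sigma>) \<circ> affine_ext f A)" .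
    then show "continuous_map (?B A) (realization L) (?h \<circ> (\<lambda>x. ((A, \<sigma>), x)))"
      by (rule continuous_map_eq)
        (simp add: realize_map_cell_pt[OF K f \<sigma>, unfolded cell_pt_def] cell_pt_def)
  qed
  then show ?thesis
    unfolding realization_def[of K]
    by (rule continuous_compose_quotient_map[OF quotient_map_quotient_topology])
qed


section \<open>Standard simplices and completeness\<close>

definition std_simplex :: "nat \<Rightarrow> (nat, unit) multicomplex_data" where
  "std_simplex n = \<lparr>mc_verts = {..n},
     mc_simps = (\<lambda>A. if A \<noteq> {} \<and> A \<subseteq> {..n} then {()} else {}),
     mc_bdry = (\<lambda>_ _ _. ())\<rparr>"

definition bd_simplex :: "nat \<Rightarrow> (nat, unit) multicomplex_data" where
  "bd_simplex n = \<lparr>mc_verts = {..n},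
     mc_simps = (\<lambda>A. if A \<noteq> {} \<and> A \<subset> {..n} then {()} else {}),
     mc_bdry = (\<lambda>_ _ _. ())\<rparr>"

lemma multicomplex_std_simplex: "multicomplex (std_simplex n)"
  by unfold_locales (auto simp: std_simplex_def intro: finite_subset[OF _ finite_atMost] split: if_splits)

lemma multicomplex_bd_simplex: "n \<ge> 1 \<Longrightarrow> multicomplex (bd_simplex n)"
proof unfold_locales
  fix v assume "n \<ge> 1" "v \<in> mc_verts (bd_simplex n)"
  then have "{v} \<subset> {..n}"
    by (cases "v = 0") (auto simp: bd_simplex_def)
  then show "\<exists>s. mc_simps (bd_simplex n) {v} = {s}" by (auto simp: bd_simplex_def)
qed (auto simp: bd_simplex_def intro: finite_subset[OF _ finite_atMost] split: if_splits)

definition bd_inclusion :: "nat \<Rightarrow> (nat, unit) mc_point \<Rightarrow> (nat, unit) mc_point" where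
  "bd_inclusion n = realize_map (bd_simplex n) (std_simplex n) (\<lambda>v. v) (\<lambda>_ \<sigma>. \<sigma>)"

definition bd_points :: "nat \<Rightarrow> (nat, unit) mc_point set" where
  "bd_points n = bd_inclusion n ` topspace (realization (bd_simplex n))"

definition homotopic_rel :: "'a topology \<Rightarrow> 'a set \<Rightarrow> 'b topology \<Rightarrow> ('a \<Rightarrow> 'b) \<Rightarrow> ('a \<Rightarrow> 'b) \<Rightarrow> bool" where
  "homotopic_rel X S Y f g \<longleftrightarrow> homotopic_with (\<lambda>h. \<forall>p\<in>S. h p = f p) X Y f g"

definition complete_multicomplex :: "('v, 's) multicomplex_data \<Rightarrow> bool" where
  "complete_multicomplex K \<longleftrightarrow>
     (\<forall>n\<ge>1. \<forall>f.
        continuous_map (realization (std_simplex n)) (realization K) f \<and>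
        (\<exists>g G. simplicial_embedding (bd_simplex n) K g G \<and>
           (\<forall>p\<in>topspace (realization (bd_simplex n)).
              f (bd_inclusion n p) = realize_map (bd_simplex n) K g G p)) \<longrightarrow>
        (\<exists>e E. simplicial_embedding (std_simplex n) K e E \<and>
           homotopic_rel (realization (std_simplex n)) (bd_points n) (realization K)
             f (realize_map (std_simplex n) K e E)))"


section \<open>Compatible and homotopic simplices\<close>

definition compatible_simplices :: "('v, 's) multicomplex_data \<Rightarrow> 'v set \<times> 's \<Rightarrow> 'v set \<times> 's \<Rightarrow> bool" where
  "compatible_simplices K \<Delta>\<^sub>1 \<Delta>\<^sub>2 \<longleftrightarrow>
     fst \<Delta>\<^sub>1 = fst \<Delta>\<^sub>2 \<and>
     (\<forall>B. B \<subset> fst \<Delta>\<^sub>1 \<and> B \<noteq> {} \<longrightarrow>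
        mc_bdry K (fst \<Delta>\<^sub>1) B (snd \<Delta>\<^sub>1) = mc_bdry K (fst \<Delta>\<^sub>2) B (snd \<Delta>\<^sub>2))"

text \<open>A characteristic map is an affine parametrization of the closed cell; it is determined by a
  bijection \<open>b\<close> between the vertices.\<close>

definition affine_param ::
  "('v, 's) multicomplex_data \<Rightarrow> nat \<Rightarrow> 'v set \<times> 's \<Rightarrow> ((nat, unit) mc_point \<Rightarrow> ('v, 's) mc_point) \<Rightarrow> bool"
  where
  "affine_param K n \<Delta> i \<longleftrightarrow>
     (\<exists>b. bij_betw b {..n} (fst \<Delta>) \<and>
        (\<forall>x\<in>barycentric {..n}.
           i (cell_pt (std_simplex n) {..n} () x) =
           cell_pt K (fst \<Delta>) (snd \<Delta>) (affine_ext b {..n} x)))"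

definition homotopic_simplices :: "('v, 's) multicomplex_data \<Rightarrow> nat \<Rightarrow> 'v set \<times> 's \<Rightarrow> 'v set \<times> 's \<Rightarrow> bool" where
  "homotopic_simplices K n \<Delta>\<^sub>1 \<Delta>\<^sub>2 \<longleftrightarrow>
     compatible_simplices K \<Delta>\<^sub>1 \<Delta>\<^sub>2 \<and>
     (\<forall>i\<^sub>1 i\<^sub>2. affine_param K n \<Delta>\<^sub>1 i\<^sub>1 \<and> affine_param K n \<Delta>\<^sub>2 i\<^sub>2 \<and> (\<forall>p\<in>bd_points n. i\<^sub>1 p = i\<^sub>2 p) \<longrightarrow>
        homotopic_rel (realization (std_simplex n)) (bd_points n) (realization K) i\<^sub>1 i\<^sub>2)"

definition compatible_class :: "('v, 's) multicomplex_data \<Rightarrow> nat \<Rightarrow> 'v set \<times> 's \<Rightarrow> ('v set \<times> 's) set" where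
  "compatible_class K n \<Delta>\<^sub>0 = {\<Delta> \<in> n_simplices K n. compatible_simplices K \<Delta> \<Delta>\<^sub>0}"


section \<open>Special spheres\<close>

text \<open>For \<open>n \<ge> 1\<close>. Over the full vertex set, \<open>False\<close> is the southern and \<open>True\<close> the northern
  simplex.\<close>

definition special_sphere :: "nat \<Rightarrow> (nat, bool) multicomplex_data" where
  "special_sphere n = \<lparr>mc_verts = {..n},
     mc_simps = (\<lambda>A. if A = {..n} then {False, True}
                     else if A \<noteq> {} \<and> A \<subseteq> {..n} then {False} else {}),
     mc_bdry = (\<lambda>A B \<sigma>. if A = B then \<sigma> else False)\<rparr>"

lemma multicomplex_special_sphere: "n \<ge> 1 \<Longrightarrow> multicomplex (special_sphere n)"
proof unfold_locales
  fix v assume "n \<ge> 1" "v \<in> mc_verts (special_sphere n)"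
  then have "{v} \<noteq> {..n}" "{v} \<subseteq> {..n}"
    by (cases "v = 0"; auto simp: special_sphere_def)+
  then show "\<exists>s. mc_simps (special_sphere n) {v} = {s}" by (auto simp: special_sphere_def)
qed (auto simp: special_sphere_def intro: finite_subset[OF _ finite_atMost] split: if_splits)

text \<open>An ordering \<open>x\<^sub>0 < \<dots> < x\<^sub>n\<close> of the vertices of an \<open>n\<close>-simplex is given as its enumeration
  \<open>x\<close>, a bijection from \<open>{..n}\<close> onto the vertex set. On vertices, the map from the special sphere
  is \<open>x\<close>; the following is its action on simplices.\<close>

definition sphere_simps ::
  "('v, 's) multicomplex_data \<Rightarrow> nat \<Rightarrow> (nat \<Rightarrow> 'v) \<Rightarrow> 'v set \<times> 's \<Rightarrow> 'v set \<times> 's \<Rightarrow> nat set \<Rightarrow> bool \<Rightarrow> 's"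
  where
  "sphere_simps K n x \<Delta>\<^sub>1 \<Delta>\<^sub>2 B \<sigma> =
     (if B = {..n} then (if \<sigma> then snd \<Delta>\<^sub>2 else snd \<Delta>\<^sub>1)
      else mc_bdry K (fst \<Delta>\<^sub>1) (x ` B) (snd \<Delta>\<^sub>1))"

lemma simplicial_map_sphere_simps:
  assumes K: "multicomplex K"
    and \<Delta>: "\<Delta>\<^sub>1 \<in> n_simplices K n" "\<Delta>\<^sub>2 \<in> n_simplices K n"
    and comp: "compatible_simplices K \<Delta>\<^sub>1 \<Delta>\<^sub>2" and x: "bij_betw x {..n} (fst \<Delta>\<^sub>1)"
  shows "simplicial_map (special_sphere n) K x (sphere_simps K n x \<Delta>\<^sub>1 \<Delta>\<^sub>2)"
proof -
  interpret multicomplex K by fact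
  obtain A \<sigma>\<^sub>1 \<sigma>\<^sub>2 where D: "\<Delta>\<^sub>1 = (A, \<sigma>\<^sub>1)" "\<Delta>\<^sub>2 = (A, \<sigma>\<^sub>2)" "\<sigma>\<^sub>1 \<in> mc_simps K A" "\<sigma>\<^sub>2 \<in> mc_simps K A"
    using \<Delta> comp by (auto simp: n_simplices_def compatible_simplices_def)
  have bd: "mc_bdry K A B \<sigma>\<^sub>1 = mc_bdry K A B \<sigma>\<^sub>2" if "B \<subset> A" "B \<noteq> {}" for B
    using comp that D by (auto simp: compatible_simplices_def)
  have xA: "x ` {..n} = A" and inj: "inj_on x {..n}"
    using x D by (auto simp: bij_betw_def)
  have sub: "x ` B \<subset> A" if "B \<subseteq> {..n}" "B \<noteq> {..n}" for B
    using that xA inj by (metis image_mono inj_on_image_eq_iff psubsetI subset_refl)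
  have AV: "A \<subseteq> mc_verts K" using D simps_over by blast
  show ?thesis
    unfolding simplicial_map_def
  proof (intro conjI allI ballI impI)
    show "x ` mc_verts (special_sphere n) \<subseteq> mc_verts K"
      using xA AV by (simp add: special_sphere_def)
  next
    fix B \<sigma> assume B: "\<sigma> \<in> mc_simps (special_sphere n) B"
    show "sphere_simps K n x \<Delta>\<^sub>1 \<Delta>\<^sub>2 B \<sigma> \<in> mc_simps K (x ` B)"
    proof (cases "B = {..n}")
      case False
      with B have "B \<noteq> {}" "B \<subseteq> {..n}" by (auto simp: special_sphere_def split: if_splits)
      then show ?thesis using False D sub[of B] by (auto simp: sphere_simps_def intro!: bdry_closed)
    qed (use D xA in \<open>auto simp: sphere_simps_def\<close>)
  next
    fix B \<sigma> C assume B: "\<sigma> \<in> mc_simps (special_sphere n) B" and C: "C \<subseteq> B" "C \<noteq> {}"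
    from B have Bn: "B \<subseteq> {..n}" by (auto simp: special_sphere_def split: if_splits)
    show "mc_bdry K (x ` B) (x ` C) (sphere_simps K n x \<Delta>\<^sub>1 \<Delta>\<^sub>2 B \<sigma>) =
        sphere_simps K n x \<Delta>\<^sub>1 \<Delta>\<^sub>2 C (mc_bdry (special_sphere n) B C \<sigma>)"
    proof (cases "B = {..n}")
      case True
      show ?thesis
      proof (cases "C = {..n}")
        case True
        then show ?thesis
          using \<open>B = {..n}\<close> D xA bdry_id by (auto simp: sphere_simps_def special_sphere_def)
      next
        case False
        then show ?thesis
          using \<open>B = {..n}\<close> D xA bd[of "x ` C"] sub[of C] C
          by (auto simp: sphere_simps_def special_sphere_def)
      qed
    next
      case False
      then have "C \<noteq> {..n}" using C Bn by auto
      then show ?thesis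
        using False D C Bn sub[of B] bdry_comp[of \<sigma>\<^sub>1 A "x ` B" "x ` C"]
        by (auto simp: sphere_simps_def image_mono)
    qed
  qed
qed

lemma sphere_simps_unique:
  assumes f: "simplicial_map (special_sphere n) K x F"
    and x: "x ` {..n} = fst \<Delta>\<^sub>1"
    and F: "F {..n} False = snd \<Delta>\<^sub>1" "F {..n} True = snd \<Delta>\<^sub>2"
    and B: "\<sigma> \<in> mc_simps (special_sphere n) B"
  shows "F B \<sigma> = sphere_simps K n x \<Delta>\<^sub>1 \<Delta>\<^sub>2 B \<sigma>"
proof (cases "B = {..n}")
  case False
  with B have B': "B \<noteq> {}" "B \<subseteq> {..n}" "\<sigma> = False" by (auto simp: special_sphere_def split: if_splits)
  have "mc_bdry K (x ` {..n}) (x ` B) (F {..n} False) = F B (mc_bdry (special_sphere n) {..n} B False)"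
    using f B' unfolding simplicial_map_def by (auto simp: special_sphere_def)
  then show ?thesis
    using False B' x F by (auto simp: sphere_simps_def special_sphere_def split: if_splits)
qed (use F in \<open>auto simp: sphere_simps_def\<close>)

definition sphere_map ::
  "('v, 's) multicomplex_data \<Rightarrow> nat \<Rightarrow> (nat \<Rightarrow> 'v) \<Rightarrow> 'v set \<times> 's \<Rightarrow> 'v set \<times> 's \<Rightarrow>
     (nat, bool) mc_point \<Rightarrow> ('v, 's) mc_point" where
  "sphere_map K n x \<Delta>\<^sub>1 \<Delta>\<^sub>2 = realize_map (special_sphere n) K x (sphere_simps K n x \<Delta>\<^sub>1 \<Delta>\<^sub>2)"


section \<open>Homotopy groups (as sets of pointed homotopy classes)\<close>

text \<open>A homotopy class is a set of total functions, which are unconstrained off the sphere. Only the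
  underlying set of the homotopy group is needed.\<close>

definition sphere_base :: "nat \<Rightarrow> real" where
  "sphere_base = (\<lambda>i. if i = 0 then 1 else 0)"

definition pointed_spheres :: "nat \<Rightarrow> 'a topology \<Rightarrow> 'a \<Rightarrow> ((nat \<Rightarrow> real) \<Rightarrow> 'a) set" where
  "pointed_spheres n X a = {f. continuous_map (nsphere n) X f \<and> f sphere_base = a}"

definition sphere_class ::
  "nat \<Rightarrow> 'a topology \<Rightarrow> 'a \<Rightarrow> ((nat \<Rightarrow> real) \<Rightarrow> 'a) \<Rightarrow> ((nat \<Rightarrow> real) \<Rightarrow> 'a) set" where
  "sphere_class n X a f = {g. homotopic_with (\<lambda>h. h sphere_base = a) (nsphere n) X f g}"

definition pi_set :: "nat \<Rightarrow> 'a topology \<Rightarrow> 'a \<Rightarrow> ((nat \<Rightarrow> real) \<Rightarrow> 'a) set set" where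
  "pi_set n X a = sphere_class n X a ` pointed_spheres n X a"

text \<open>\<open>\<phi>\<close> is the chosen pointed homeomorphism from the round sphere to the special sphere.\<close>

definition Theta ::
  "('v, 's) multicomplex_data \<Rightarrow> nat \<Rightarrow> (nat \<Rightarrow> 'v) \<Rightarrow> ((nat \<Rightarrow> real) \<Rightarrow> (nat, bool) mc_point) \<Rightarrow>
     'v set \<times> 's \<Rightarrow> 'v set \<times> 's \<Rightarrow> ((nat \<Rightarrow> real) \<Rightarrow> ('v, 's) mc_point) set" where
  "Theta K n x \<phi> \<Delta>\<^sub>0 \<Delta> =
     sphere_class n (realization K) (vertex_pt K (x 0)) (sphere_map K n x \<Delta>\<^sub>0 \<Delta> \<circ> \<phi>)"

end

theory Submission
  imports Defs
begin

text \<open>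
  A pointed map on the special sphere is a pair of maps on the simplex (south, north) that agree on
  the boundary. Both halves of the theorem reduce to transporting the northern map along a homotopy
  of its boundary values, using the homotopy extension property of a simplex and its boundary.

  Surjectivity: the south of a sphere is deformed to the characteristic map of \<open>\<Delta>\<^sub>0\<close> through the
  base point, since the simplex contracts to its base vertex; the north is dragged along and ends as
  a map which agrees with \<open>\<Delta>\<^sub>0\<close> on the boundary, and completeness replaces it by a simplex.

  Injectivity: let a pointed homotopy join \<open>(u, v)\<close> to \<open>(u, v')\<close>. At each time, transport the north
  along the contraction of the current south to the base point followed by the expansion to \<open>u\<close>.
  The boundary values of the result do not depend on time, and at the two ends the transport is
  along a path followed by its reverse, so that it changes \<open>v\<close> and \<open>v'\<close> only by a homotopy
  relative to the boundary.
\<close>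

section \<open>Homotopy extension for a simplex and its boundary\<close>

abbreviation cell :: "nat \<Rightarrow> (nat \<Rightarrow> real) set" where
  "cell n \<equiv> barycentric {..n}"

definition cell_bd :: "nat \<Rightarrow> (nat \<Rightarrow> real) set" where
  "cell_bd n = {z \<in> cell n. \<exists>i\<le>n. z i = 0}"

lemma cell_bd_subset: "cell_bd n \<subseteq> cell n"
  by (auto simp: cell_bd_def)

text \<open>The Minkowski gauge of the simplex about its barycenter: it is \<open>1\<close> exactly on the boundary.\<close>

definition gauge_fn :: "nat \<Rightarrow> (nat \<Rightarrow> real) \<Rightarrow> real" where
  "gauge_fn n z = 1 - real (n + 1) * Min (z ` {..n})"

text \<open>The homothety of ratio \<open>\<kappa>\<close> about the barycenter. For
  \<open>\<kappa> \<ge> 0\<close> it multiplies the gauge by \<open>\<kappa>\<close>, which is why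
  the product \<open>\<kappa> * gauge_fn n z\<close> decides where the image lies.\<close>

definition radial :: "nat \<Rightarrow> real \<Rightarrow> (nat \<Rightarrow> real) \<Rightarrow> nat \<Rightarrow> real" where
  "radial n \<kappa> z = (\<lambda>i. if i \<le> n then 1 / real (n + 1) + \<kappa> * (z i - 1 / real (n + 1)) else 0)"

lemma continuous_on_coordinate:
  fixes f :: "'a::topological_space \<Rightarrow> nat \<Rightarrow> real"
  assumes "continuous_on S f"
  shows "continuous_on S (\<lambda>x. f x i)"
  using assms by (rule continuous_on_product_then_coordinatewise)

lemma continuous_on_gauge:
  assumes "continuous_on S f"
  shows "continuous_on S (\<lambda>x. gauge_fn n (f x))"
proof -
  have "continuous_on S (\<lambda>x. Min (f x ` {..m}))" for m
  proof (induction m)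
    case 0
    then show ?case using continuous_on_coordinate[OF assms] by simp
  next
    case (Suc m)
    then show ?case
      using continuous_on_coordinate[OF assms, of "Suc m"]
      by (simp add: atMost_Suc Min_insert) (intro continuous_intros)
  qed
  then show ?thesis
    unfolding gauge_fn_def by (intro continuous_intros)
qed

lemma cell_sum_one:
  assumes "z \<in> cell n"
  shows "(\<Sum>i\<le>n. z i) = 1" "0 \<le> z i" "i > n \<Longrightarrow> z i = 0"
  using assms by (auto simp: barycentric_def)

text \<open>The least coordinate lies between 0 and the average \<open>1 / (n + 1)\<close>, because
  the coordinates are nonnegative and add up to 1.\<close>

lemma gauge_bounds:
  assumes "z \<in> cell n"
  shows "0 \<le> gauge_fn n z" "gauge_fn n z \<le> 1"
proof -
  have "(\<Sum>i\<le>n. Min (z ` {..n})) \<le> (\<Sum>i\<le>n. z i)"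
    by (intro sum_mono Min_le) auto
  then show "0 \<le> gauge_fn n z"
    using cell_sum_one(1)[OF assms] by (simp add: gauge_fn_def algebra_simps)
  have "0 \<le> Min (z ` {..n})"
    using cell_sum_one(2)[OF assms] by (subst Min_ge_iff) auto
  then show "gauge_fn n z \<le> 1" by (simp add: gauge_fn_def)
qed

lemma gauge_bd: "z \<in> cell_bd n \<Longrightarrow> gauge_fn n z = 1"
proof -
  assume z: "z \<in> cell_bd n"
  then have "Min (z ` {..n}) = 0"
    by (intro Min_eqI) (auto simp: cell_bd_def barycentric_def image_iff)
  then show ?thesis by (simp add: gauge_fn_def)
qed

text \<open>The first summand does not depend on \<open>i\<close> and is nonnegative as long as the
  scaled gauge is at most 1; the second vanishes where the coordinate is minimal. Membership in the
  simplex and in its boundary can be read off from this form.\<close>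

lemma radial_coord:
  assumes "i \<le> n"
  shows "radial n \<kappa> z i = (1 - \<kappa> * gauge_fn n z) / real (n + 1) + \<kappa> * (z i - Min (z ` {..n}))"
  using assms by (simp add: radial_def gauge_fn_def field_simps)

lemma radial_in_cell:
  assumes z: "z \<in> cell n" and \<kappa>: "0 \<le> \<kappa>" "\<kappa> * gauge_fn n z \<le> 1"
  shows "radial n \<kappa> z \<in> cell n"
proof -
  have "0 \<le> radial n \<kappa> z i" for i
  proof (cases "i \<le> n")
    case True
    then show ?thesis using \<kappa> unfolding radial_coord[OF True]
      by (intro add_nonneg_nonneg mult_nonneg_nonneg divide_nonneg_nonneg) auto
  qed (simp add: radial_def)
  moreover have "(\<Sum>i\<le>n. radial n \<kappa> z i) = 1"
  proof -
    have "(\<Sum>i\<le>n. radial n \<kappa> z i) = (\<Sum>i\<le>n. 1 / real (n + 1) + \<kappa> * (z i - 1 / real (n + 1)))"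
      by (rule sum.cong) (auto simp: radial_def)
    also have "\<dots> = 1 + \<kappa> * ((\<Sum>i\<le>n. z i) - 1)"
      by (simp add: sum.distrib sum_subtractf flip: sum_distrib_left)
    finally show ?thesis using cell_sum_one(1)[OF z] by simp
  qed
  ultimately show ?thesis by (auto simp: barycentric_def radial_def)
qed

lemma radial_in_bd:
  assumes z: "z \<in> cell n" and \<kappa>: "0 \<le> \<kappa>" "\<kappa> * gauge_fn n z = 1"
  shows "radial n \<kappa> z \<in> cell_bd n"
proof -
  have "Min (z ` {..n}) \<in> z ` {..n}" by (intro Min_in) auto
  then obtain i where "i \<le> n" "z i = Min (z ` {..n})" by (metis atMost_iff imageE)
  then have "radial n \<kappa> z i = 0" using \<kappa> by (simp add: radial_coord)
  then show ?thesis
    using radial_in_cell[OF z \<kappa>(1)] \<kappa>(2) \<open>i \<le> n\<close> by (auto simp: cell_bd_def)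
qed

lemma radial_one: "z \<in> cell n \<Longrightarrow> radial n 1 z = z"
  by (auto simp: radial_def fun_eq_iff barycentric_def)

text \<open>Points of gauge at most \<open>1 / (1 + s)\<close> are scaled by \<open>1 + s\<close>;
  all others are pushed radially onto the boundary. For \<open>s \<ge> 0\<close> the lower bound in
  the maximum also keeps the denominator positive at the barycenter.\<close>

definition stretch :: "nat \<Rightarrow> real \<Rightarrow> (nat \<Rightarrow> real) \<Rightarrow> nat \<Rightarrow> real" where
  "stretch n s z = radial n (1 / max (gauge_fn n z) (1 / (1 + s))) z"

lemma stretch_in_cell:
  assumes "z \<in> cell n" "0 \<le> s"
  shows "stretch n s z \<in> cell n"
  unfolding stretch_def using assms gauge_bounds(1)[OF assms(1)]
  by (intro radial_in_cell) (auto simp: field_simps max_def)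

lemma stretch_in_bd:
  assumes "z \<in> cell n" "0 \<le> s" "1 \<le> gauge_fn n z * (1 + s)"
  shows "stretch n s z \<in> cell_bd n"
proof -
  have g: "0 < gauge_fn n z" "0 \<le> gauge_fn n z" using assms(3) gauge_bounds[OF assms(1)] by (auto simp: less_le)
  then have "1 / (1 + s) \<le> gauge_fn n z"
    using assms by (simp add: divide_le_eq)
  then show ?thesis
    unfolding stretch_def using assms g by (intro radial_in_bd) (auto simp: max_def)
qed

lemma stretch_zero: "z \<in> cell n \<Longrightarrow> stretch n 0 z = z"
  using gauge_bounds[of z n] by (simp add: stretch_def radial_one max_def)

lemma stretch_bd: "z \<in> cell_bd n \<Longrightarrow> 0 \<le> s \<Longrightarrow> stretch n s z = z"
  using gauge_bd[of z n] radial_one[of z n] cell_bd_subset[of n]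
  by (auto simp: stretch_def max_def field_simps)

lemma continuous_on_stretch:
  assumes s: "continuous_on S s" "\<And>x. x \<in> S \<Longrightarrow> 0 \<le> s x" and f: "continuous_on S f"
  shows "continuous_on S (\<lambda>x. stretch n (s x) (f x))"
proof (rule continuous_on_coordinatewise_then_product)
  fix i
  have "max (gauge_fn n (f x)) (1 / (1 + s x)) \<noteq> 0" if "x \<in> S" for x
    using s(2)[OF that] by (simp add: max_def) (smt (verit) divide_pos_pos)
  moreover have "1 + s x \<noteq> 0" if "x \<in> S" for x
    using s(2)[OF that] by simp
  ultimately show "continuous_on S (\<lambda>x. stretch n (s x) (f x) i)"
    unfolding stretch_def radial_def
    by (cases "i \<le> n")
      (auto intro!: continuous_intros continuous_on_gauge f s(1) continuous_on_coordinate[OF f])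
qed

section \<open>Composing and gluing maps on subsets, and the collar extension\<close>

lemma continuous_map_compose_on:
  assumes "continuous_map (top_of_set S) Y f" "continuous_on S' g" "g \<in> S' \<rightarrow> S"
  shows "continuous_map (top_of_set S') Y (\<lambda>x. f (g x))"
proof -
  have "continuous_map (top_of_set S') (top_of_set S) g"
    using assms(2,3) by (auto simp: continuous_map_in_subtopology)
  from continuous_map_compose[OF this assms(1)] show ?thesis by (simp add: o_def)
qed

lemma continuous_map_cases_le_on:
  fixes p q :: "'a::topological_space \<Rightarrow> real"
  assumes "continuous_on S p" "continuous_on S q"
    and "continuous_map (top_of_set {x \<in> S. p x \<le> q x}) Y f"
    and "continuous_map (top_of_set {x \<in> S. q x \<le> p x}) Y g"
    and "\<And>x. x \<in> S \<Longrightarrow> p x = q x \<Longrightarrow> f x = g x"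
  shows "continuous_map (top_of_set S) Y (\<lambda>x. if p x \<le> q x then f x else g x)"
proof -
  have *: "S \<inter> {x \<in> S. P x} = {x \<in> S. P x}" for P by auto
  show ?thesis
    by (rule continuous_map_cases_le) (use assms in \<open>auto simp: subtopology_subtopology *\<close>)
qed

text \<open>The extension of a homotopy \<open>c\<close> of the boundary over the simplex, starting from \<open>q\<close>: the
  standard retraction of \<open>T \<times> I\<close> onto \<open>T \<times> 0 \<union> \<partial>T \<times> I\<close>, carrying a parameter \<open>p\<close> along.\<close>

definition collar_ext ::
  "nat \<Rightarrow> ('p \<times> (nat \<Rightarrow> real) \<Rightarrow> 'y) \<Rightarrow> ('p \<times> real \<times> (nat \<Rightarrow> real) \<Rightarrow> 'y) \<Rightarrow>
     'p \<Rightarrow> real \<Rightarrow> (nat \<Rightarrow> real) \<Rightarrow> 'y" where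
  "collar_ext n q c p s z =
     (if gauge_fn n z * (1 + s) \<le> 1 then q (p, stretch n s z)
      else c (p, gauge_fn n z * (1 + s) - 1, stretch n s z))"

lemma collar_ext_zero: "z \<in> cell n \<Longrightarrow> collar_ext n q c p 0 z = q (p, z)"
  using gauge_bounds[of z n] by (simp add: collar_ext_def stretch_zero)

lemma collar_ext_bd:
  assumes "z \<in> cell_bd n" "0 \<le> s" "c (p, 0, z) = q (p, z)"
  shows "collar_ext n q c p s z = c (p, s, z)"
  using assms by (auto simp: collar_ext_def stretch_bd gauge_bd)

text \<open>The two clauses meet where the gauge times \<open>1 + s\<close> equals 1. There the
  stretched point lies on the boundary and \<open>c\<close> is evaluated at time 0, so
  \<open>qc\<close> makes them agree.\<close>

lemma continuous_map_collar_ext: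
  fixes q :: "'p::topological_space \<times> (nat \<Rightarrow> real) \<Rightarrow> 'y"
  assumes q: "continuous_map (top_of_set (P \<times> cell n)) Y q"
    and c: "continuous_map (top_of_set (P \<times> {0..1} \<times> cell_bd n)) Y c"
    and qc: "\<And>p z. p \<in> P \<Longrightarrow> z \<in> cell_bd n \<Longrightarrow> c (p, 0, z) = q (p, z)"
  shows "continuous_map (top_of_set (P \<times> {0..1} \<times> cell n)) Y
           (\<lambda>(p, s, z). collar_ext n q c p s z)"
proof -
  let ?S = "P \<times> {0..1} \<times> cell n"
  have st: "continuous_on S (\<lambda>x. stretch n (fst (snd x)) (snd (snd x)))" if "S \<subseteq> ?S" for S
    by (rule continuous_on_stretch) (use that in \<open>auto intro!: continuous_on_fst continuous_on_snd continuous_on_id\<close>)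
  have ga: "continuous_on S (\<lambda>x. gauge_fn n (snd (snd x)) * (1 + fst (snd x)))" for S :: "('p \<times> real \<times> _) set"
    by (intro continuous_intros continuous_on_gauge)
  \<comment> \<open>This keeps the time passed to \<open>c\<close> within the unit interval.\<close>
  have "gauge_fn n z * (1 + s) \<le> 2" if "z \<in> cell n" "0 \<le> s" "s \<le> 1" for s z
    using mult_mono[of "gauge_fn n z" 1 "1 + s" 2] gauge_bounds[OF that(1)] that by auto
  then have "continuous_map (top_of_set ?S) Y (\<lambda>x.
      if gauge_fn n (snd (snd x)) * (1 + fst (snd x)) \<le> 1
      then q (fst x, stretch n (fst (snd x)) (snd (snd x)))
      else c (fst x, gauge_fn n (snd (snd x)) * (1 + fst (snd x)) - 1, stretch n (fst (snd x)) (snd (snd x))))"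
    by (intro continuous_map_cases_le_on continuous_map_compose_on[OF q]
        continuous_map_compose_on[OF c] continuous_intros ga st)
      (auto intro!: qc[symmetric] stretch_in_cell stretch_in_bd)
  then show ?thesis by (simp add: collar_ext_def case_prod_unfold)
qed

section \<open>The straight-line contraction of the simplex to its base vertex\<close>

definition contract :: "real \<Rightarrow> (nat \<Rightarrow> real) \<Rightarrow> nat \<Rightarrow> real" where
  "contract r z = (\<lambda>i. (1 - r) * z i + r * sphere_base i)"

lemma sphere_base_cell: "sphere_base \<in> cell n"
  by (auto simp: sphere_base_def barycentric_def)

lemma contract_in_cell:
  assumes "z \<in> cell n" "0 \<le> r" "r \<le> 1"
  shows "contract r z \<in> cell n"
  using assms sphere_base_cell[of n]
  by (auto simp: barycentric_def contract_def sum.distrib simp flip: sum_distrib_left)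

text \<open>The third equation, by which the base vertex never moves, makes the homotopies built
  from \<open>contract\<close> pointed.\<close>

lemma contract_simps [simp]:
  "contract 0 z = z" "contract 1 z = sphere_base" "contract r sphere_base = sphere_base"
  by (auto simp: contract_def fun_eq_iff algebra_simps)

lemma continuous_on_contract:
  assumes "continuous_on S r" "continuous_on S f"
  shows "continuous_on S (\<lambda>x. contract (r x) (f x))"
  unfolding contract_def
  by (intro continuous_on_coordinatewise_then_product continuous_intros assms(1)
      continuous_on_coordinate[OF assms(2)])

section \<open>Homotopy relative to a subset\<close>

lemma homotopic_rel_iff:
  assumes "S \<subseteq> topspace X"
  shows "homotopic_rel X S Y f g \<longleftrightarrow>
    (\<exists>h. continuous_map (prod_topology (top_of_set {0..1::real}) X) Y h \<and>
       (\<forall>x\<in>topspace X. h (0, x) = f x) \<and> (\<forall>x\<in>topspace X. h (1, x) = g x) \<and>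
       (\<forall>t\<in>{0..1}. \<forall>x\<in>S. h (t, x) = f x))"
  unfolding homotopic_rel_def
  by (subst homotopic_with) (use assms in \<open>auto simp: subset_iff\<close>)

lemma homotopic_rel_on:
  assumes "S \<subseteq> T"
  shows "homotopic_rel (top_of_set T) S Y f g \<longleftrightarrow>
    (\<exists>h. continuous_map (top_of_set ({0..1::real} \<times> T)) Y h \<and>
       (\<forall>x\<in>T. h (0, x) = f x \<and> h (1, x) = g x) \<and> (\<forall>t\<in>{0..1}. \<forall>x\<in>S. h (t, x) = f x))"
  by (subst homotopic_rel_iff) (use assms in \<open>simp_all add: prod_topology_subtopology_eu ball_conj_distrib conj_assoc\<close>)

lemma homotopic_rel_agree:
  assumes "homotopic_rel X S Y f g" "x \<in> S"
  shows "g x = f x"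
  using homotopic_with_imp_property[OF assms(1)[unfolded homotopic_rel_def]] assms(2) by auto

lemma homotopic_rel_sym:
  assumes "homotopic_rel X S Y f g"
  shows "homotopic_rel X S Y g f"
  using assms homotopic_rel_agree[OF assms]
  unfolding homotopic_rel_def by (simp add: homotopic_with_sym cong: ball_cong)

lemma homotopic_rel_trans:
  assumes "homotopic_rel X S Y f g" "homotopic_rel X S Y g h"
  shows "homotopic_rel X S Y f h"
  using assms homotopic_rel_agree[OF assms(1)]
  unfolding homotopic_rel_def by (auto intro: homotopic_with_trans cong: ball_cong)

lemmas continuous_pair_intros =
  continuous_on_const continuous_on_id continuous_on_fst continuous_on_snd continuous_on_Pair
  continuous_on_add continuous_on_diff continuous_on_mult continuous_on_min continuous_on_max
  continuous_on_contract

text \<open>Conjugating by the path from a boundary point to the base vertex and back is undone by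
  letting the path only go part of the way.\<close>

lemma homotopic_rel_collar_conj:
  assumes u: "continuous_map (top_of_set (cell n)) Y u"
    and v: "continuous_map (top_of_set (cell n)) Y v"
    and uv: "\<And>z. z \<in> cell_bd n \<Longrightarrow> v z = u z"
  shows "homotopic_rel (top_of_set (cell n)) (cell_bd n) Y v
    (collar_ext n (v \<circ> snd) (\<lambda>(t, s, y). u (contract (min (2 * s) (2 - 2 * s)) y)) (t::real) 1)"
proof -
  \<comment> \<open>With parameter \<open>l\<close> the path goes out to contraction
    \<open>l\<close>, reached at time \<open>l / 2\<close>, and is back at time \<open>l\<close>;
    the truncation at 0 lets it rest from then on.\<close>
  define c where "c = (\<lambda>(l::real, s::real, y). u (contract (max 0 (min (2 * s) (2 * l - 2 * s))) y))"
  \<comment> \<open>The collar has height \<open>l\<close> as well. So \<open>l = 0\<close> gives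
    \<open>v\<close>, and every boundary point sits at the end of its closed path, that is at its
    initial value.\<close>
  define h where "h = (\<lambda>(l, z). collar_ext n (v \<circ> snd) c l l z)"
  have cv: "c (l, 0, z) = (v \<circ> snd) (l, z)" if "z \<in> cell_bd n" "l \<in> {0..1}" for l z
    using that by (simp add: c_def uv)
  have "continuous_map (top_of_set ({0..1} \<times> cell n)) Y (v \<circ> snd)"
    unfolding o_def by (rule continuous_map_compose_on[OF v]) (auto intro!: continuous_pair_intros)
  moreover have "continuous_map (top_of_set ({0..1} \<times> {0..1} \<times> cell_bd n)) Y c"
    unfolding c_def case_prod_unfold
    by (rule continuous_map_compose_on[OF u])
      (use cell_bd_subset[of n] in \<open>auto intro!: continuous_pair_intros contract_in_cell simp: mult.commute\<close>)
  ultimately have "continuous_map (top_of_set ({0..1} \<times> {0..1} \<times> cell n)) Y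
      (\<lambda>(p, s, z). collar_ext n (v \<circ> snd) c p s z)"
    by (rule continuous_map_collar_ext) (use cv in auto)
  then have "continuous_map (top_of_set ({0..1} \<times> cell n)) Y
      (\<lambda>x. case (fst x, x) of (p, s, z) \<Rightarrow> collar_ext n (v \<circ> snd) c p s z)"
    by (rule continuous_map_compose_on) (auto intro!: continuous_pair_intros)
  then have "continuous_map (top_of_set ({0..1} \<times> cell n)) Y h"
    by (simp add: h_def case_prod_unfold)
  moreover have "h (0, z) = v z" if "z \<in> cell n" for z
    using that by (simp add: h_def collar_ext_zero)
  moreover have "h (1, z) =
      collar_ext n (v \<circ> snd) (\<lambda>(t, s, y). u (contract (min (2 * s) (2 - 2 * s)) y)) t 1 z"
    if "z \<in> cell n" for z
    using gauge_bounds[OF that] by (simp add: h_def collar_ext_def c_def max_def)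
  moreover have "h (t, z) = v z" if "z \<in> cell_bd n" "t \<in> {0..1}" for t z
    using that uv unfolding h_def by (subst split, subst collar_ext_bd) (auto simp: c_def)
  ultimately show ?thesis
    by (subst homotopic_rel_on[OF cell_bd_subset]) blast
qed

section \<open>Homotopies of pairs of maps that agree on the boundary\<close>

text \<open>A pointed homotopy on the special sphere, cut along the equator into a southern part
  \<open>H\<close> and a northern part \<open>G\<close>. For \<open>n \<ge> 1\<close> the base
  vertex lies on the boundary, so the condition at the base point passes from \<open>H\<close> to
  \<open>G\<close>.\<close>

definition two_cell_homotopic ::
  "nat \<Rightarrow> 'y topology \<Rightarrow> 'y \<Rightarrow> ((nat \<Rightarrow> real) \<Rightarrow> 'y) \<Rightarrow> ((nat \<Rightarrow> real) \<Rightarrow> 'y) \<Rightarrow>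
     ((nat \<Rightarrow> real) \<Rightarrow> 'y) \<Rightarrow> ((nat \<Rightarrow> real) \<Rightarrow> 'y) \<Rightarrow> bool" where
  "two_cell_homotopic n Y a p q p' q' \<longleftrightarrow>
     (\<exists>H G. continuous_map (top_of_set ({0..1::real} \<times> cell n)) Y H \<and>
        continuous_map (top_of_set ({0..1} \<times> cell n)) Y G \<and>
        (\<forall>t\<in>{0..1}. \<forall>z\<in>cell_bd n. H (t, z) = G (t, z)) \<and>
        (\<forall>t\<in>{0..1}. H (t, sphere_base) = a) \<and>
        (\<forall>z\<in>cell n. H (0, z) = p z \<and> G (0, z) = q z \<and> H (1, z) = p' z \<and> G (1, z) = q' z))"

text \<open>\<open>G\<close> already joins \<open>v\<close> to \<open>v'\<close>, but its boundary
  values move with \<open>H\<close>. Attaching to each \<open>G (t, _)\<close> a collar that leads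
  the boundary values back to those of \<open>u\<close> makes them independent of
  \<open>t\<close>.\<close>

lemma two_cell_homotopic_imp_rel:
  assumes "two_cell_homotopic n Y a u v u v'"
  shows "homotopic_rel (top_of_set (cell n)) (cell_bd n) Y v v'"
proof -
  from assms obtain H G where
    H: "continuous_map (top_of_set ({0..1::real} \<times> cell n)) Y H"
    and G: "continuous_map (top_of_set ({0..1} \<times> cell n)) Y G"
    and HG: "\<And>t z. t \<in> {0..1} \<Longrightarrow> z \<in> cell_bd n \<Longrightarrow> H (t, z) = G (t, z)"
    and Ha: "\<And>t. t \<in> {0..1} \<Longrightarrow> H (t, sphere_base) = a"
    and ends: "\<And>z. z \<in> cell n \<Longrightarrow> H (0, z) = u z" "\<And>z. z \<in> cell n \<Longrightarrow> G (0, z) = v z"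
      "\<And>z. z \<in> cell n \<Longrightarrow> H (1, z) = u z" "\<And>z. z \<in> cell n \<Longrightarrow> G (1, z) = v' z"
    unfolding two_cell_homotopic_def by blast
  have slice: "continuous_map (top_of_set (cell n)) Y (\<lambda>z. F (t, z))"
    if "continuous_map (top_of_set ({0..1::real} \<times> cell n)) Y F" "t \<in> {0..1}" for F t
    by (rule continuous_map_compose_on[OF that(1)]) (use that(2) in \<open>auto intro!: continuous_pair_intros\<close>)
  have u: "continuous_map (top_of_set (cell n)) Y u"
    using continuous_map_eq[OF slice[OF H, of 0]] ends(1) by auto
  have v: "continuous_map (top_of_set (cell n)) Y v"
    using continuous_map_eq[OF slice[OF G, of 0]] ends(2) by auto
  have v': "continuous_map (top_of_set (cell n)) Y v'"
    using continuous_map_eq[OF slice[OF G, of 1]] ends(4) by auto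
  have uv: "v z = u z" "v' z = u z" if "z \<in> cell_bd n" for z
    using that HG[of 0 z] HG[of 1 z] ends[of z] cell_bd_subset by auto
  \<comment> \<open>The path starts at the current value \<open>H (t, y)\<close>, passes through the
    base point at time 1/2 and ends at \<open>u y\<close>, whatever \<open>t\<close> is.\<close>
  define c where "c = (\<lambda>(t::real, s::real, y).
    if s \<le> 1/2 then H (t, contract (2 * s) y) else u (contract (2 - 2 * s) y))"
  let ?cu = "\<lambda>(t::real, s, y). u (contract (min (2 * s) (2 - 2 * s)) y)"
  define h where "h = (\<lambda>(t, z). collar_ext n G c t 1 z)"
  have bd: "z \<in> cell n" if "z \<in> cell_bd n" for z using that cell_bd_subset by auto
  \<comment> \<open>Both clauses of \<open>c\<close> have run into the base vertex at
    \<open>s = 1/2\<close>, and \<open>H\<close> and \<open>u\<close> take the same value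
    \<open>a\<close> there.\<close>
  have "u sphere_base = a"
    using Ha[of 0] ends(1)[OF sphere_base_cell] by simp
  then have "continuous_map (top_of_set ({0..1} \<times> {0..1} \<times> cell_bd n)) Y c"
    unfolding c_def case_prod_unfold
    by (intro continuous_map_cases_le_on continuous_map_compose_on[OF u] continuous_map_compose_on[OF H])
      (use bd Ha in \<open>auto intro!: continuous_pair_intros contract_in_cell simp: mult.commute\<close>)
  then have "continuous_map (top_of_set ({0..1} \<times> {0..1} \<times> cell n)) Y
      (\<lambda>(p, s, z). collar_ext n G c p s z)"
    by (rule continuous_map_collar_ext[OF G]) (use HG in \<open>auto simp: c_def\<close>)
  then have "continuous_map (top_of_set ({0..1} \<times> cell n)) Y
      (\<lambda>x. case (fst x, 1, snd x) of (p, s, z) \<Rightarrow> collar_ext n G c p s z)"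
    by (rule continuous_map_compose_on) (auto intro!: continuous_pair_intros)
  then have "continuous_map (top_of_set ({0..1} \<times> cell n)) Y h"
    by (simp add: h_def case_prod_unfold)
  \<comment> \<open>When the south at time \<open>t\<close> is \<open>u\<close> itself, as it is for
    \<open>t = 0\<close> and \<open>t = 1\<close>, the path \<open>c\<close> goes out along
    \<open>u\<close> and back: it is \<open>?cu\<close>.\<close>
  moreover have *: "h (t, z) = collar_ext n (w \<circ> snd) ?cu 0 1 z"
    if "z \<in> cell n" "t \<in> {0..1}" "\<And>z. z \<in> cell n \<Longrightarrow> H (t, z) = u z"
      "\<And>z. z \<in> cell n \<Longrightarrow> G (t, z) = w z" for t z w
  proof -
    have "stretch n 1 z \<in> cell n" by (intro stretch_in_cell that) auto
    then show ?thesis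
      using gauge_bounds[OF that(1)] that(3,4) contract_in_cell
      by (auto simp: h_def collar_ext_def c_def min_def field_simps)
  qed
  moreover have "h (t, z) = u z" if "z \<in> cell_bd n" "t \<in> {0..1}" for t z
    using that HG unfolding h_def by (subst split, subst collar_ext_bd) (auto simp: c_def)
  moreover have "collar_ext n (v \<circ> snd) ?cu 0 1 z = u z" if "z \<in> cell_bd n" for z
    using that uv by (subst collar_ext_bd) auto
  ultimately have "homotopic_rel (top_of_set (cell n)) (cell_bd n) Y
      (collar_ext n (v \<circ> snd) ?cu 0 1) (collar_ext n (v' \<circ> snd) ?cu 0 1)"
    by (subst homotopic_rel_on[OF cell_bd_subset]) (intro exI[of _ h], auto simp: * ends)
  \<comment> \<open>The conjugation lemma removes the out-and-back collar from both ends of this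
    homotopy.\<close>
  then show ?thesis
    using homotopic_rel_collar_conj[OF u v uv(1), of 0] homotopic_rel_collar_conj[OF u v' uv(2), of 0]
    by (meson homotopic_rel_trans homotopic_rel_sym)
qed

text \<open>The north moves with its boundary fixed, so the south can stay constant.\<close>

lemma rel_imp_two_cell_homotopic:
  assumes u: "continuous_map (top_of_set (cell n)) Y u" and "u sphere_base = a"
    and "homotopic_rel (top_of_set (cell n)) (cell_bd n) Y v v'"
    and uv: "\<And>z. z \<in> cell_bd n \<Longrightarrow> v z = u z"
  shows "two_cell_homotopic n Y a u v u v'"
proof -
  from assms(3) obtain h where "continuous_map (top_of_set ({0..1::real} \<times> cell n)) Y h"
    "\<forall>x\<in>cell n. h (0, x) = v x \<and> h (1, x) = v' x" "\<forall>t\<in>{0..1}. \<forall>x\<in>cell_bd n. h (t, x) = v x"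
    by (subst (asm) homotopic_rel_on[OF cell_bd_subset]) blast
  moreover have "continuous_map (top_of_set ({0..1::real} \<times> cell n)) Y (\<lambda>x. u (snd x))"
    by (rule continuous_map_compose_on[OF u]) (auto intro!: continuous_pair_intros)
  ultimately show ?thesis
    unfolding two_cell_homotopic_def
    by (intro exI[of _ "\<lambda>x. u (snd x)"] exI[of _ h]) (use assms(2) uv in auto)
qed

text \<open>The south runs from \<open>p\<close> through the base point to \<open>u\<close>.
  Homotopy extension lets the north follow its boundary values, and \<open>w\<close> is where the
  north ends.\<close>

lemma two_cell_homotopic_south:
  assumes p: "continuous_map (top_of_set (cell n)) Y p"
    and q: "continuous_map (top_of_set (cell n)) Y q"
    and u: "continuous_map (top_of_set (cell n)) Y u"
    and pq: "\<And>z. z \<in> cell_bd n \<Longrightarrow> p z = q z"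
    and a: "p sphere_base = a" "u sphere_base = a"
  obtains w where "continuous_map (top_of_set (cell n)) Y w"
    "\<And>z. z \<in> cell_bd n \<Longrightarrow> w z = u z" "two_cell_homotopic n Y a p q u w"
proof -
  define H where "H = (\<lambda>(s::real, y).
    if s \<le> 1/2 then p (contract (2 * s) y) else u (contract (2 - 2 * s) y))"
  \<comment> \<open>A single homotopy is extended here, so the collar parameter is frozen at 0 and
    the collar height \<open>s\<close> serves as time.\<close>
  define G where "G = (\<lambda>(s, z). collar_ext n (q \<circ> snd) (H \<circ> snd) (0::real) s z)"
  have bd: "z \<in> cell n" if "z \<in> cell_bd n" for z using that cell_bd_subset by auto
  have H: "continuous_map (top_of_set ({0..1} \<times> cell n)) Y H"
    unfolding H_def case_prod_unfold
    by (intro continuous_map_cases_le_on continuous_map_compose_on[OF p] continuous_map_compose_on[OF u])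
      (use a in \<open>auto intro!: continuous_pair_intros contract_in_cell simp: mult.commute\<close>)
  have "continuous_map (top_of_set (UNIV \<times> {0..1} \<times> cell n)) Y
      (\<lambda>(p, s, z). collar_ext n (q \<circ> snd) (H \<circ> snd) (p::real) s z)"
    unfolding o_def
    by (intro continuous_map_collar_ext continuous_map_compose_on[OF q] continuous_map_compose_on[OF H])
      (use bd pq in \<open>auto intro!: continuous_pair_intros simp: H_def\<close>)
  then have "continuous_map (top_of_set ({0..1} \<times> cell n)) Y
      (\<lambda>x. case (0::real, x) of (p, s, z) \<Rightarrow> collar_ext n (q \<circ> snd) (H \<circ> snd) p s z)"
    by (rule continuous_map_compose_on[where g = "\<lambda>x. (0, x)"]) (auto intro!: continuous_pair_intros)
  then have G: "continuous_map (top_of_set ({0..1} \<times> cell n)) Y G"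
    by (simp add: G_def case_prod_unfold)
  have HG: "H (t, z) = G (t, z)" if "z \<in> cell_bd n" "t \<in> {0..1}" for t z
    using that pq unfolding G_def by (subst split, subst collar_ext_bd) (auto simp: H_def)
  show ?thesis
  proof
    show "continuous_map (top_of_set (cell n)) Y (\<lambda>z. G (1, z))"
      by (rule continuous_map_compose_on[OF G]) (auto intro!: continuous_pair_intros)
    show "G (1, z) = u z" if "z \<in> cell_bd n" for z
      using HG[OF that, of 1] by (simp add: H_def)
    show "two_cell_homotopic n Y a p q u (\<lambda>z. G (1, z))"
      unfolding two_cell_homotopic_def
      by (intro exI[of _ H] exI[of _ G])
        (use H G HG a in \<open>auto simp: H_def G_def collar_ext_zero\<close>)
  qed
qed

section \<open>Cells of a realization\<close>

text \<open>An invariant of the gluing: the face that contains the point in its interior, with the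
  barycentric coordinates. The vertex set of that face is the support of the coordinates.\<close>

definition normal_form ::
  "('v, 's) multicomplex_data \<Rightarrow> ('v set \<times> 's) \<times> ('v \<Rightarrow> real) \<Rightarrow> 's \<times> ('v \<Rightarrow> real)" where
  "normal_form K p = (mc_bdry K (fst (fst p)) {v. snd p v \<noteq> 0} (snd (fst p)), snd p)"

lemma support_barycentric:
  assumes "x \<in> barycentric A"
  shows "{v. x v \<noteq> 0} \<subseteq> A" "{v. x v \<noteq> 0} \<noteq> {}"
proof -
  show "{v. x v \<noteq> 0} \<subseteq> A" using assms by (auto simp: barycentric_def)
  have "sum x A \<noteq> 0" using assms by (simp add: barycentric_def)
  then show "{v. x v \<noteq> 0} \<noteq> {}" by (metis (mono_tags) empty_Collect_eq sum.neutral)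
qed

lemma barycentric_support:
  assumes "x \<in> barycentric A" "finite A"
  shows "x \<in> barycentric {v. x v \<noteq> 0}"
proof -
  have "sum x {v. x v \<noteq> 0} = sum x A"
    using assms(2) support_barycentric(1)[OF assms(1)] by (intro sum.mono_neutral_left) auto
  then show ?thesis using assms(1) by (simp add: barycentric_def)
qed

text \<open>Gluing keeps the coordinates and hence their support. By \<open>bdry_comp\<close>, going
  to the face over the support through an intermediate face gives the same simplex as going there
  directly.\<close>

lemma normal_form_glue_class:
  assumes K: "multicomplex K" and "q \<in> glue_class K p"
  shows "normal_form K q = normal_form K p"
proof -
  interpret multicomplex K by fact
  have glue: "normal_form K q = normal_form K p" if pq: "(p, q) \<in> gluing K" for p q
  proof -
    from pq obtain A B \<sigma> x where *: "p = ((A, \<sigma>), x)" "q = ((B, mc_bdry K A B \<sigma>), x)"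
      "\<sigma> \<in> mc_simps K A" "B \<subseteq> A" "x \<in> barycentric B"
      by (auto simp: gluing_def)
    then show ?thesis
      using bdry_comp[OF *(3,4) support_barycentric[OF *(5)]] by (simp add: normal_form_def)
  qed
  from assms(2) have "(p, q) \<in> (gluing K \<union> (gluing K)\<inverse>)\<^sup>*"
    by (simp add: glue_class_def)
  then show ?thesis
    by (induction rule: rtrancl_induct) (auto dest: glue)
qed

lemma cell_pt_eqD:
  assumes "multicomplex K" "cell_pt K A \<sigma> x = cell_pt K B \<tau> y"
  shows "x = y" "mc_bdry K A {v. x v \<noteq> 0} \<sigma> = mc_bdry K B {v. x v \<noteq> 0} \<tau>"
proof -
  have "((A, \<sigma>), x) \<in> glue_class K ((B, \<tau>), y)"
    using assms(2) glue_class_self unfolding cell_pt_def by metis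
  from normal_form_glue_class[OF assms(1) this]
  show "x = y" "mc_bdry K A {v. x v \<noteq> 0} \<sigma> = mc_bdry K B {v. x v \<noteq> 0} \<tau>"
    by (auto simp: normal_form_def)
qed

text \<open>In a multicomplex all representatives of a point share their coordinates. The resulting
  map is a left inverse of every cell map at once, and it is continuous on the whole
  realization.\<close>

definition mc_coord :: "('v, 's) mc_point \<Rightarrow> 'v \<Rightarrow> real" where
  "mc_coord c = the_elem (snd ` c)"

lemma mc_coord_glue_class: "multicomplex K \<Longrightarrow> mc_coord (glue_class K p) = snd p"
proof -
  assume "multicomplex K"
  then have "snd ` glue_class K p = {snd p}"
    using normal_form_glue_class[of K _ p] glue_class_self[of p K]
    by (force simp: normal_form_def image_iff)
  then show ?thesis by (simp add: mc_coord_def)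
qed

lemma mc_coord_cell_pt: "multicomplex K \<Longrightarrow> mc_coord (cell_pt K A \<sigma> x) = x"
  by (simp add: cell_pt_def mc_coord_glue_class)

lemma continuous_map_mc_coord:
  assumes "multicomplex K"
  shows "continuous_map (realization K) (powertop_real UNIV) mc_coord"
  unfolding realization_def
proof (rule continuous_compose_quotient_map[OF quotient_map_quotient_topology], unfold cell_sum_def)
  show "continuous_map (sum_topology (\<lambda>(A, \<sigma>). subtopology (powertop_real UNIV) (barycentric A))
      {(A, \<sigma>). \<sigma> \<in> mc_simps K A}) (powertop_real UNIV) (mc_coord \<circ> glue_class K)"
    by (rule sum_topology_continuous)
      (auto simp: o_def mc_coord_glue_class[OF assms] intro: continuous_map_from_subtopology)
qed

lemma continuous_map_cell_pt:
  assumes "\<sigma> \<in> mc_simps K A"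
  shows "continuous_map (subtopology (powertop_real UNIV) (barycentric A)) (realization K) (cell_pt K A \<sigma>)"
proof -
  have "continuous_map (subtopology (powertop_real UNIV) (barycentric A)) (cell_sum K) (Pair (A, \<sigma>))"
    using continuous_map_component_injection[of "(A, \<sigma>)" "{(A, \<sigma>). \<sigma> \<in> mc_simps K A}"
        "\<lambda>(A, \<sigma>). subtopology (powertop_real UNIV) (barycentric A)"] assms
    by (simp add: cell_sum_def)
  moreover have "continuous_map (cell_sum K) (realization K) (glue_class K)"
    unfolding realization_def
    by (rule quotient_imp_continuous_map[OF quotient_map_quotient_topology])
  ultimately show ?thesis
    by (auto dest: continuous_map_compose simp: o_def cell_pt_def[abs_def])
qed

section \<open>Affine extensions of vertex maps\<close>

lemma continuous_map_affine_ext: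
  assumes "finite A"
  shows "continuous_map (subtopology (powertop_real UNIV) (barycentric A))
    (subtopology (powertop_real UNIV) (barycentric (f ` A))) (affine_ext f A)"
proof -
  have "continuous_map (subtopology (powertop_real UNIV) (barycentric A)) (powertop_real UNIV) (affine_ext f A)"
    unfolding continuous_map_componentwise_UNIV affine_ext_def
    by (intro allI continuous_map_sum continuous_map_from_subtopology
        continuous_map_product_projection) (use assms in auto)
  then show ?thesis
    using affine_ext_barycentric[OF assms, of _ f] by (auto simp: continuous_map_in_subtopology)
qed

lemma top_of_set_cell: "top_of_set (cell n) = subtopology (powertop_real UNIV) (cell n)"
  by (simp add: euclidean_product_topology)

text \<open>The fibre of \<open>f \<circ> g\<close> over a point is partitioned by the values of
  \<open>g\<close>.\<close>

lemma affine_ext_compose: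
  assumes "finite A"
  shows "affine_ext f (g ` A) (affine_ext g A z) = affine_ext (f \<circ> g) A z"
proof
  fix w
  have "(\<Sum>v\<in>{v \<in> g ` A. f v = w}. \<Sum>u\<in>{u \<in> A. g u = v}. z u) =
      (\<Sum>v\<in>g ` {u \<in> A. f (g u) = w}. \<Sum>u\<in>{u \<in> {u \<in> A. f (g u) = w}. g u = v}. z u)"
    by (rule sum.cong) (auto intro!: sum.cong)
  also have "\<dots> = sum z {u \<in> A. f (g u) = w}"
    by (rule sum.group) (use assms in auto)
  finally show "affine_ext f (g ` A) (affine_ext g A z) w = affine_ext (f \<circ> g) A z w"
    by (simp add: affine_ext_def)
qed

lemma affine_ext_inj:
  assumes "inj_on f A" "v \<in> A"
  shows "affine_ext f A z (f v) = z v"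
proof -
  have "{u \<in> A. f u = f v} = {v}" using assms by (auto dest: inj_onD)
  then show ?thesis by (simp add: affine_ext_def)
qed

lemma affine_ext_cong: "(\<And>v. v \<in> A \<Longrightarrow> f v = g v) \<Longrightarrow> affine_ext f A = affine_ext g A"
  by (auto simp: affine_ext_def fun_eq_iff intro!: sum.cong)

lemma affine_ext_id:
  assumes "finite A" "z \<in> barycentric A"
  shows "affine_ext (\<lambda>v. v) A z = z"
proof
  fix w
  have "{v \<in> A. v = w} = (if w \<in> A then {w} else {})" by auto
  then show "affine_ext (\<lambda>v. v) A z w = z w"
    using assms by (auto simp: affine_ext_def barycentric_def)
qed

lemma support_affine_ext:
  assumes "inj_on f A" "z \<in> barycentric A"
  shows "{w. affine_ext f A z w \<noteq> 0} = f ` {v. z v \<noteq> 0}"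
proof -
  have "affine_ext f A z w = 0" if "w \<notin> f ` A" for w
    unfolding affine_ext_def by (rule sum.neutral) (use that in auto)
  then show ?thesis
    using affine_ext_inj[OF assms(1)] support_barycentric(1)[OF assms(2)] by (auto simp: image_iff) metis+
qed

definition vertex_coord :: "'v \<Rightarrow> 'v \<Rightarrow> real" where
  "vertex_coord v = (\<lambda>w. if w = v then 1 else 0)"

lemma vertex_coord_support [simp]: "{w. vertex_coord v w \<noteq> 0} = {v}"
  by (auto simp: vertex_coord_def)

lemma vertex_coord_barycentric: "finite A \<Longrightarrow> v \<in> A \<Longrightarrow> vertex_coord v \<in> barycentric A"
  by (auto simp: vertex_coord_def barycentric_def)

lemma vertex_coord_eq_iff: "vertex_coord v = vertex_coord w \<longleftrightarrow> v = w"
  by (metis vertex_coord_support singleton_inject)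

lemma affine_ext_vertex_coord:
  assumes "finite A" "v \<in> A"
  shows "affine_ext f A (vertex_coord v) = vertex_coord (f v)"
  using assms by (auto simp: affine_ext_def vertex_coord_def fun_eq_iff)

lemma sphere_base_vertex_coord: "sphere_base = vertex_coord 0"
  by (auto simp: sphere_base_def vertex_coord_def)

text \<open>The face of \<open>\<sigma>\<close> over \<open>{v}\<close> must be the only simplex
  there, so the point depends on \<open>v\<close> alone.\<close>

lemma cell_pt_vertex_coord:
  assumes "multicomplex K" "\<sigma> \<in> mc_simps K A" "v \<in> A"
  shows "cell_pt K A \<sigma> (vertex_coord v) = vertex_pt K v"
proof -
  interpret multicomplex K by fact
  have "A \<subseteq> mc_verts K" using simps_over assms(2) by blast
  then obtain s where s: "mc_simps K {v} = {s}" using simps_vertex assms(3) by blast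
  have "mc_bdry K A {v} \<sigma> \<in> mc_simps K {v}" using bdry_closed assms by blast
  then show ?thesis
    using cell_pt_face[OF assms(2), of "{v}" "vertex_coord v"] assms(3) s
    by (simp add: vertex_pt_def vertex_coord_def[symmetric] vertex_coord_barycentric)
qed

section \<open>Characteristic maps of simplices\<close>

definition char_map ::
  "('v, 's) multicomplex_data \<Rightarrow> nat \<Rightarrow> (nat \<Rightarrow> 'v) \<Rightarrow> 'v set \<times> 's \<Rightarrow> (nat \<Rightarrow> real) \<Rightarrow> ('v, 's) mc_point"
  where
  "char_map K n x \<Delta> z = cell_pt K (fst \<Delta>) (snd \<Delta>) (affine_ext x {..n} z)"

lemma continuous_map_char_map:
  assumes "\<Delta> \<in> n_simplices K n" "x ` {..n} = fst \<Delta>"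
  shows "continuous_map (top_of_set (cell n)) (realization K) (char_map K n x \<Delta>)"
proof -
  have "snd \<Delta> \<in> mc_simps K (fst \<Delta>)" using assms(1) by (auto simp: n_simplices_def)
  from continuous_map_cell_pt[OF this] continuous_map_affine_ext[of "{..n}" x] assms(2)
  show ?thesis
    unfolding top_of_set_cell by (auto dest: continuous_map_compose simp: o_def char_map_def[abs_def])
qed

lemma char_map_base:
  assumes "multicomplex K" "\<Delta> \<in> n_simplices K n" "x ` {..n} = fst \<Delta>"
  shows "char_map K n x \<Delta> sphere_base = vertex_pt K (x 0)"
  using assms cell_pt_vertex_coord[of K "snd \<Delta>" "fst \<Delta>" "x 0"]
  by (auto simp: char_map_def sphere_base_vertex_coord affine_ext_vertex_coord n_simplices_def)

text \<open>A boundary point is carried by the face over its support. This face is proper, and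
  compatible simplices have the same proper faces.\<close>

lemma char_map_compatible:
  assumes "\<Delta> \<in> n_simplices K n" "\<Delta>' \<in> n_simplices K n"
    and "compatible_simplices K \<Delta> \<Delta>'" and x: "bij_betw x {..n} (fst \<Delta>)" and z: "z \<in> cell_bd n"
  shows "char_map K n x \<Delta> z = char_map K n x \<Delta>' z"
proof -
  let ?B = "x ` {i. z i \<noteq> 0}"
  have zc: "z \<in> cell n" using z cell_bd_subset by auto
  have inj: "inj_on x {..n}" and im: "x ` {..n} = fst \<Delta>" using x by (auto simp: bij_betw_def)
  have supp: "{i. z i \<noteq> 0} \<subset> {..n}" using z support_barycentric[OF zc] by (auto simp: cell_bd_def)
  have B: "?B \<subset> fst \<Delta>" "?B \<noteq> {}"
    using image_strict_mono[OF inj supp] im support_barycentric[OF zc] by auto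
  have y: "affine_ext x {..n} z \<in> barycentric ?B"
  proof -
    have "z \<in> barycentric {i. z i \<noteq> 0}"
      using zc by (rule barycentric_support) simp
    then show ?thesis
      using affine_ext_face[of "{..n}" "{i. z i \<noteq> 0}" z x] affine_ext_barycentric[of "{i. z i \<noteq> 0}" z x] supp
      by (auto intro: finite_subset[of _ "{..n}"])
  qed
  have s: "snd \<Delta> \<in> mc_simps K (fst \<Delta>)" "snd \<Delta>' \<in> mc_simps K (fst \<Delta>')"
    using assms(1,2) by (auto simp: n_simplices_def)
  have f: "fst \<Delta> = fst \<Delta>'" and "mc_bdry K (fst \<Delta>) ?B (snd \<Delta>) = mc_bdry K (fst \<Delta>') ?B (snd \<Delta>')"
    using assms(3) B unfolding compatible_simplices_def by blast+
  moreover have "?B \<subseteq> fst \<Delta>" using B(1) by blast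
  ultimately show ?thesis
    unfolding char_map_def
    using cell_pt_face[OF s(1) _ B(2) y] cell_pt_face[OF s(2) _ B(2) y] by simp
qed

section \<open>The standard simplex and its boundary as realizations\<close>

abbreviation std_pt :: "nat \<Rightarrow> (nat \<Rightarrow> real) \<Rightarrow> (nat, unit) mc_point" where
  "std_pt n \<equiv> cell_pt (std_simplex n) {..n} ()"

lemma std_pt_eq:
  assumes "A \<noteq> {}" "A \<subseteq> {..n}" "z \<in> barycentric A"
  shows "cell_pt (std_simplex n) A () z = std_pt n z"
  using cell_pt_face[of "()" "std_simplex n" "{..n}" A z] assms by (simp add: std_simplex_def)

lemma barycentric_mono:
  assumes "finite B" "A \<subseteq> B" "z \<in> barycentric A"
  shows "z \<in> barycentric B"
  using assms sum.mono_neutral_left[of B A z] by (auto simp: barycentric_def)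

lemma topspace_std: "topspace (realization (std_simplex n)) = std_pt n ` cell n"
proof -
  have "cell_pt (std_simplex n) A () z \<in> std_pt n ` cell n"
    if "A \<noteq> {}" "A \<subseteq> {..n}" "z \<in> barycentric A" for A z
    using std_pt_eq[OF that] barycentric_mono[OF _ that(2,3)] by auto
  then show ?thesis
    by (auto simp: topspace_realization std_simplex_def)
qed

lemma cell_bd_face:
  assumes "z \<in> cell_bd n"
  obtains B where "B \<noteq> {}" "B \<subset> {..n}" "z \<in> barycentric B"
proof
  have zc: "z \<in> cell n" using assms cell_bd_subset by auto
  show "{i. z i \<noteq> 0} \<noteq> {}" "{i. z i \<noteq> 0} \<subset> {..n}"
    using support_barycentric[OF zc] assms by (auto simp: cell_bd_def)
  then show "z \<in> barycentric {i. z i \<noteq> 0}"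
    using barycentric_support[OF zc] by simp
qed

lemma face_cell_bd:
  assumes "B \<subset> {..n}" "z \<in> barycentric B"
  shows "z \<in> cell_bd n"
  using assms barycentric_mono[OF _ psubset_imp_subset[OF assms(1)] assms(2)]
  by (auto simp: cell_bd_def barycentric_def)

lemma bd_inclusion_cell_pt:
  assumes "1 \<le> n" "B \<noteq> {}" "B \<subset> {..n}" "z \<in> barycentric B"
  shows "bd_inclusion n (cell_pt (bd_simplex n) B () z) = std_pt n z"
proof -
  have "simplicial_map (bd_simplex n) (std_simplex n) (\<lambda>v. v) (\<lambda>_ \<sigma>. \<sigma>)"
    by (auto simp: simplicial_map_def bd_simplex_def std_simplex_def)
  then have "bd_inclusion n (cell_pt (bd_simplex n) B () z) =
      cell_pt (std_simplex n) ((\<lambda>v. v) ` B) () (affine_ext (\<lambda>v. v) B z)"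
    unfolding bd_inclusion_def using assms
    by (intro realize_map_cell_pt multicomplex_bd_simplex) (auto simp: bd_simplex_def)
  moreover have "finite B" using assms(3) finite_subset[of B "{..n}"] by auto
  ultimately show ?thesis
    using assms std_pt_eq[of B n z] by (simp add: affine_ext_id psubset_imp_subset)
qed

text \<open>Together with the mutually inverse maps \<open>std_pt n\<close> and
  \<open>mc_coord\<close>, this moves relative homotopies between the realized standard simplex and
  the concrete pair \<open>cell n\<close>, \<open>cell_bd n\<close>.\<close>

lemma bd_points_eq:
  assumes "1 \<le> n"
  shows "bd_points n = std_pt n ` cell_bd n"
proof
  show "bd_points n \<subseteq> std_pt n ` cell_bd n"
  proof
    fix p assume "p \<in> bd_points n"
    then obtain B z where B: "B \<noteq> {}" "B \<subset> {..n}" and z: "z \<in> barycentric B"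
      and "p = bd_inclusion n (cell_pt (bd_simplex n) B () z)"
      unfolding bd_points_def topspace_realization by (auto simp: bd_simplex_def split: if_splits)
    then show "p \<in> std_pt n ` cell_bd n"
      using bd_inclusion_cell_pt[OF assms B z] face_cell_bd[OF B(2) z] by auto
  qed
  show "std_pt n ` cell_bd n \<subseteq> bd_points n"
  proof clarify
    fix z assume "z \<in> cell_bd n"
    then obtain B where "B \<noteq> {}" "B \<subset> {..n}" "z \<in> barycentric B" by (rule cell_bd_face)
    moreover from this have "cell_pt (bd_simplex n) B () z \<in> topspace (realization (bd_simplex n))"
      unfolding topspace_realization by (auto simp: bd_simplex_def)
    ultimately show "std_pt n z \<in> bd_points n"
      using bd_inclusion_cell_pt[OF assms] unfolding bd_points_def by (metis image_eqI)
  qed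
qed

lemma continuous_map_std_pt: "continuous_map (top_of_set (cell n)) (realization (std_simplex n)) (std_pt n)"
  unfolding top_of_set_cell by (rule continuous_map_cell_pt) (auto simp: std_simplex_def)

lemma continuous_map_coord_std:
  "continuous_map (realization (std_simplex n)) (top_of_set (cell n)) mc_coord"
  unfolding top_of_set_cell
  by (auto simp: continuous_map_in_subtopology continuous_map_mc_coord multicomplex_std_simplex
      topspace_std mc_coord_cell_pt)

section \<open>Homotopy of simplices in terms of one ordering of the vertices\<close>

lemma homotopic_rel_compose:
  assumes "homotopic_rel X S Y f g" "continuous_map X' X k" "k ` S' \<subseteq> S"
  shows "homotopic_rel X' S' Y (f \<circ> k) (g \<circ> k)"
  using assms(1,2) unfolding homotopic_rel_def
  by (rule homotopic_with_compose_continuous_map_right) (use assms(3) in auto)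

lemma homotopic_rel_cong:
  assumes "homotopic_rel X S Y f g" "S \<subseteq> topspace X"
    and "\<And>x. x \<in> topspace X \<Longrightarrow> f x = f' x" "\<And>x. x \<in> topspace X \<Longrightarrow> g x = g' x"
  shows "homotopic_rel X S Y f' g'"
  using assms(1,3,4) subsetD[OF assms(2)] unfolding homotopic_rel_iff[OF assms(2)] by (metis (no_types, lifting))

text \<open>The definition ranges over all pairs of affine parametrizations that agree on the
  boundary. Such a pair uses the same bijection of vertices, which differs from \<open>x\<close> by
  a permutation, and the permutation acts on the simplex and on its boundary.\<close>

lemma homotopic_simplices_iff:
  assumes K: "multicomplex K" and n: "1 \<le> n"
    and \<Delta>: "\<Delta> \<in> n_simplices K n" "\<Delta>' \<in> n_simplices K n"
    and comp: "compatible_simplices K \<Delta> \<Delta>'" and x: "bij_betw x {..n} (fst \<Delta>)"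
  shows "homotopic_simplices K n \<Delta> \<Delta>' \<longleftrightarrow>
    homotopic_rel (top_of_set (cell n)) (cell_bd n) (realization K) (char_map K n x \<Delta>) (char_map K n x \<Delta>')"
    (is "?L \<longleftrightarrow> ?R")
proof
  have cs: "cell_bd n \<subseteq> topspace (top_of_set (cell n))" using cell_bd_subset by simp
  have fst_eq: "fst \<Delta>' = fst \<Delta>" using comp by (simp add: compatible_simplices_def)
  have S: "multicomplex (std_simplex n)" by (rule multicomplex_std_simplex)
  {
    assume ?L
    let ?i = "\<lambda>\<Delta> p. char_map K n x \<Delta> (mc_coord p)"
    have "affine_param K n \<Delta> (?i \<Delta>)" "affine_param K n \<Delta>' (?i \<Delta>')"
      using x fst_eq unfolding affine_param_def
      by (auto intro!: exI[of _ x] simp: char_map_def mc_coord_cell_pt[OF S])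
    moreover have "\<forall>p\<in>bd_points n. ?i \<Delta> p = ?i \<Delta>' p"
      using char_map_compatible[OF \<Delta> comp x] by (auto simp: bd_points_eq[OF n] mc_coord_cell_pt[OF S])
    ultimately have "homotopic_rel (realization (std_simplex n)) (bd_points n) (realization K) (?i \<Delta>) (?i \<Delta>')"
      using \<open>?L\<close> by (simp add: homotopic_simplices_def)
    from homotopic_rel_compose[OF this continuous_map_std_pt, of "cell_bd n"]
    have "homotopic_rel (top_of_set (cell n)) (cell_bd n) (realization K) (?i \<Delta> \<circ> std_pt n) (?i \<Delta>' \<circ> std_pt n)"
      by (simp add: bd_points_eq[OF n])
    then show ?R
      by (rule homotopic_rel_cong[OF _ cs]) (auto simp: mc_coord_cell_pt[OF S])
  }
  assume R: ?R
  show ?L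
    unfolding homotopic_simplices_def
  proof (intro conjI allI impI comp, elim conjE)
    fix i\<^sub>1 i\<^sub>2 assume i: "affine_param K n \<Delta> i\<^sub>1" "affine_param K n \<Delta>' i\<^sub>2" "\<forall>p\<in>bd_points n. i\<^sub>1 p = i\<^sub>2 p"
    from i(1) obtain b where b: "bij_betw b {..n} (fst \<Delta>)"
      "\<And>z. z \<in> cell n \<Longrightarrow> i\<^sub>1 (std_pt n z) = char_map K n b \<Delta> z"
      by (auto simp: affine_param_def char_map_def)
    from i(2) obtain b' where b': "bij_betw b' {..n} (fst \<Delta>)"
      "\<And>z. z \<in> cell n \<Longrightarrow> i\<^sub>2 (std_pt n z) = char_map K n b' \<Delta>' z"
      by (auto simp: affine_param_def char_map_def fst_eq)
    \<comment> \<open>As \<open>n \<ge> 1\<close>, every vertex is a boundary point, and there the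
      two parametrizations agree.\<close>
    have bb: "b' j = b j" if "j \<in> {..n}" for j
    proof -
      have "{j} \<subset> {..n}" using n that by (cases "j = 0") auto
      then have v: "vertex_coord j \<in> cell_bd n"
        by (rule face_cell_bd) (simp add: vertex_coord_barycentric)
      then have "char_map K n b \<Delta> (vertex_coord j) = char_map K n b' \<Delta>' (vertex_coord j)"
        using i(3) b(2) b'(2) cell_bd_subset[of n] by (simp add: bd_points_eq[OF n] subset_iff)
      then show ?thesis
        using that cell_pt_eqD(1)[OF K] unfolding char_map_def
        by (metis affine_ext_vertex_coord finite_atMost vertex_coord_eq_iff)
    qed
    \<comment> \<open>The permutation by which \<open>b\<close> differs from \<open>x\<close>:
      precomposing with its affine extension turns the parametrization by \<open>x\<close> into the
      one by \<open>b\<close>.\<close>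
    define \<pi> where "\<pi> = inv_into {..n} x \<circ> b"
    have \<pi>: "bij_betw \<pi> {..n} {..n}"
      unfolding \<pi>_def using b(1) bij_betw_inv_into[OF x] by (rule bij_betw_trans)
    have x\<pi>: "x (\<pi> j) = b j" if "j \<in> {..n}" for j
      using that bij_betwE[OF b(1)] bij_betw_inv_into_right[OF x] by (simp add: \<pi>_def)
    have \<pi>im: "\<pi> ` {..n} = {..n}" and \<pi>inj: "inj_on \<pi> {..n}" using \<pi> by (auto simp: bij_betw_def)
    have char: "char_map K n x \<Gamma> (affine_ext \<pi> {..n} z) = char_map K n b \<Gamma> z" for \<Gamma> z
    proof -
      have "affine_ext x {..n} (affine_ext \<pi> {..n} z) = affine_ext (x \<circ> \<pi>) {..n} z"
        using affine_ext_compose[of "{..n}" x \<pi> z] \<pi>im by simp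
      also have "affine_ext (x \<circ> \<pi>) {..n} = affine_ext b {..n}"
        by (rule affine_ext_cong) (use x\<pi> in simp)
      finally show ?thesis by (simp add: char_map_def)
    qed
    have "continuous_map (top_of_set (cell n)) (top_of_set (cell n)) (affine_ext \<pi> {..n})"
      using continuous_map_affine_ext[of "{..n}" \<pi>] \<pi>im by (simp add: top_of_set_cell)
    with continuous_map_coord_std
    have k: "continuous_map (realization (std_simplex n)) (top_of_set (cell n)) (affine_ext \<pi> {..n} \<circ> mc_coord)"
      by (rule continuous_map_compose)
    have "affine_ext \<pi> {..n} z \<in> cell_bd n" if "z \<in> cell_bd n" for z
    proof -
      obtain j where "j \<le> n" "z j = 0" "z \<in> cell n"
        using \<open>z \<in> cell_bd n\<close> unfolding cell_bd_def by blast
      moreover have "\<pi> j \<le> n" using \<pi>im \<open>j \<le> n\<close> by auto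
      ultimately show ?thesis
        using affine_ext_inj[OF \<pi>inj, of j z] affine_ext_barycentric[of "{..n}" z \<pi>] \<pi>im
        by (auto simp: cell_bd_def)
    qed
    then have "(affine_ext \<pi> {..n} \<circ> mc_coord) ` bd_points n \<subseteq> cell_bd n"
      by (auto simp: bd_points_eq[OF n] mc_coord_cell_pt[OF S])
    from homotopic_rel_compose[OF R k this]
    show "homotopic_rel (realization (std_simplex n)) (bd_points n) (realization K) i\<^sub>1 i\<^sub>2"
    proof (rule homotopic_rel_cong)
      show "bd_points n \<subseteq> topspace (realization (std_simplex n))"
        using cell_bd_subset by (auto simp: bd_points_eq[OF n] topspace_std)
      have "char_map K n b' \<Delta>' z = char_map K n b \<Delta>' z" for z
        using affine_ext_cong[of "{..n}" b' b] bb by (simp add: char_map_def)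
      then show
        "\<And>p. p \<in> topspace (realization (std_simplex n)) \<Longrightarrow>
          (char_map K n x \<Delta> \<circ> (affine_ext \<pi> {..n} \<circ> mc_coord)) p = i\<^sub>1 p"
        "\<And>p. p \<in> topspace (realization (std_simplex n)) \<Longrightarrow>
          (char_map K n x \<Delta>' \<circ> (affine_ext \<pi> {..n} \<circ> mc_coord)) p = i\<^sub>2 p"
        using b(2) b'(2) char by (auto simp: topspace_std mc_coord_cell_pt[OF S])
    qed
  qed
qed

section \<open>Maps on the special sphere\<close>

abbreviation hemisphere_pt :: "nat \<Rightarrow> bool \<Rightarrow> (nat \<Rightarrow> real) \<Rightarrow> (nat, bool) mc_point" where
  "hemisphere_pt n \<equiv> cell_pt (special_sphere n) {..n}"

lemma hemisphere_pt_face: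
  assumes "B \<noteq> {}" "B \<subset> {..n}" "z \<in> barycentric B"
  shows "hemisphere_pt n \<sigma> z = cell_pt (special_sphere n) B False z"
  using cell_pt_face[of \<sigma> "special_sphere n" "{..n}" B z] assms
  by (auto simp: special_sphere_def psubset_eq)

lemma hemisphere_pt_bd: "z \<in> cell_bd n \<Longrightarrow> hemisphere_pt n \<sigma> z = hemisphere_pt n \<tau> z"
  by (metis cell_bd_face hemisphere_pt_face)

lemma topspace_special_sphere:
  "topspace (realization (special_sphere n)) = (\<Union>\<sigma>. hemisphere_pt n \<sigma> ` cell n)"
proof -
  have *: "cell_pt (special_sphere n) B False z \<in> (\<Union>\<sigma>. hemisphere_pt n \<sigma> ` cell n)"
    if "B \<noteq> {}" "B \<subseteq> {..n}" "z \<in> barycentric B" for B z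
  proof (cases "B = {..n}")
    case False
    then have "cell_pt (special_sphere n) B False z = hemisphere_pt n False z"
      using hemisphere_pt_face[of B n z] that by (simp add: psubset_eq)
    then show ?thesis using barycentric_mono[OF _ that(2,3)] by auto
  qed (use that in auto)
  have "cell_pt (special_sphere n) B \<sigma> z \<in> (\<Union>\<sigma>. hemisphere_pt n \<sigma> ` cell n)"
    if "\<sigma> \<in> mc_simps (special_sphere n) B" "z \<in> barycentric B" for B \<sigma> z
  proof -
    have "B = {..n} \<or> B \<noteq> {} \<and> B \<subseteq> {..n} \<and> \<not> \<sigma>"
      using that(1) by (simp add: special_sphere_def split: if_splits)
    then show ?thesis using * that(2) by (cases \<sigma>) auto
  qed
  moreover have "\<sigma> \<in> mc_simps (special_sphere n) {..n}" for \<sigma>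
    by (cases \<sigma>) (simp_all add: special_sphere_def)
  ultimately show ?thesis
    unfolding topspace_realization by blast
qed

text \<open>If no coordinate vanishes, the face over the support is the whole simplex, which tells
  north from south. Otherwise the point lies on the boundary.\<close>

lemma hemisphere_pt_eqD:
  assumes "1 \<le> n" "z \<in> cell n" "hemisphere_pt n \<sigma> z = hemisphere_pt n \<tau> w"
  shows "w = z" "\<sigma> = \<tau> \<or> z \<in> cell_bd n"
proof -
  note * = cell_pt_eqD[OF multicomplex_special_sphere[OF assms(1)] assms(3)]
  show "w = z" using *(1) by simp
  show "\<sigma> = \<tau> \<or> z \<in> cell_bd n"
  proof (cases "{i. z i \<noteq> 0} = {..n}")
    case True
    then show ?thesis using *(2) by (simp add: special_sphere_def)
  next
    case False
    then show ?thesis using assms(2) support_barycentric(1)[OF assms(2)] by (auto simp: cell_bd_def)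
  qed
qed

lemma continuous_map_hemisphere_pt:
  "continuous_map (top_of_set (cell n)) (realization (special_sphere n)) (hemisphere_pt n \<sigma>)"
  unfolding top_of_set_cell
  by (rule continuous_map_cell_pt) (cases \<sigma>; simp add: special_sphere_def)

lemma hemisphere_pt_base:
  assumes "1 \<le> n"
  shows "hemisphere_pt n \<sigma> sphere_base = vertex_pt (special_sphere n) 0"
proof -
  have "\<sigma> \<in> mc_simps (special_sphere n) {..n}"
    by (cases \<sigma>) (simp_all add: special_sphere_def)
  then show ?thesis
    using cell_pt_vertex_coord[OF multicomplex_special_sphere[OF assms]]
    by (simp add: sphere_base_vertex_coord)
qed

text \<open>The simplex is a closed subset of a cube with infinitely many factors, which is compact
  by Tychonoff's theorem.\<close>

lemma compact_cell: "compact (cell n)"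
proof -
  have "compactin (product_topology (\<lambda>i. euclideanreal) UNIV) (PiE UNIV (\<lambda>i::nat. {0..1}))"
    by (subst compactin_PiE) auto
  then have "compact (PiE UNIV (\<lambda>i::nat. {0..1::real}))"
    by (simp add: euclidean_product_topology flip: compactin_euclidean_iff)
  moreover have "closed {z::nat \<Rightarrow> real. (\<forall>i. 0 \<le> z i) \<and> (\<forall>i. i \<notin> {..n} \<longrightarrow> z i = 0) \<and> (\<Sum>i\<le>n. z i) = 1}"
    by (intro closed_Collect_conj closed_Collect_all closed_Collect_imp closed_Collect_le closed_Collect_eq
        open_Collect_const continuous_on_product_coordinates continuous_on_sum continuous_on_const)
  moreover have "z i \<le> 1" if "z \<in> cell n" for z i
  proof (cases "i \<le> n")
    case True
    then have "z i \<le> (\<Sum>i\<le>n. z i)"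
      using that by (intro member_le_sum) (auto simp: barycentric_def)
    then show ?thesis using that by (simp add: barycentric_def)
  qed (use that in \<open>simp add: barycentric_def\<close>)
  ultimately have "compact (PiE UNIV (\<lambda>i. {0..1}) \<inter> cell n)"
    unfolding barycentric_def by (intro compact_Int_closed) simp_all
  also have "PiE UNIV (\<lambda>i. {0..1}) \<inter> cell n = cell n"
    using \<open>\<And>z i. z \<in> cell n \<Longrightarrow> z i \<le> 1\<close> by (auto simp: barycentric_def)
  finally show ?thesis .
qed

text \<open>The cylinders over the two hemispheres are closed and cover the product, so continuity
  can be checked on each of them. This avoids asking whether the product of the quotient map with an
  interval is again a quotient map.\<close>

lemma continuous_map_special_sphere_paste:
  fixes H :: "bool \<Rightarrow> real \<times> (nat \<Rightarrow> real) \<Rightarrow> 'y"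
  assumes n: "1 \<le> n" and "Hausdorff_space (realization (special_sphere n))"
    and H: "\<And>\<sigma>. continuous_map (top_of_set ({0..1} \<times> cell n)) Y (H \<sigma>)"
    and bd: "\<And>t z. t \<in> {0..1} \<Longrightarrow> z \<in> cell_bd n \<Longrightarrow> H False (t, z) = H True (t, z)"
  obtains h where
    "continuous_map (prod_topology (top_of_set {0..1}) (realization (special_sphere n))) Y h"
    "\<And>t z \<sigma>. t \<in> {0..1} \<Longrightarrow> z \<in> cell n \<Longrightarrow> h (t, hemisphere_pt n \<sigma> z) = H \<sigma> (t, z)"
proof -
  let ?S = "realization (special_sphere n)"
  let ?X = "prod_topology (top_of_set {0..1::real}) ?S"
  let ?C = "\<lambda>\<sigma>. hemisphere_pt n \<sigma> ` cell n"
  let ?h = "\<lambda>\<sigma> (t, p). H \<sigma> (t, mc_coord p)"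
  \<comment> \<open>Points of the equator fall under the northern clause; \<open>bd'\<close> shows
    that the southern formula gives the same value.\<close>
  define h where "h = (\<lambda>(t, p). if p \<in> ?C True then ?h True (t, p) else ?h False (t, p))"
  have K: "multicomplex (special_sphere n)" using n by (rule multicomplex_special_sphere)
  have bd': "H \<sigma> (t, z) = H \<tau> (t, z)" if "t \<in> {0..1}" "z \<in> cell_bd n" for \<sigma> \<tau> t z
    using bd[OF that] by (cases \<sigma>; cases \<tau>) auto
  have h: "h (t, hemisphere_pt n \<sigma> z) = H \<sigma> (t, z)" if tz: "t \<in> {0..1}" "z \<in> cell n" for t z \<sigma>
  proof -
    have "H True (t, z) = H \<sigma> (t, z)" if "hemisphere_pt n \<sigma> z \<in> ?C True"
      using that hemisphere_pt_eqD[OF n tz(2)] bd'[OF tz(1)] by blast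
    moreover have "\<not> \<sigma>" if "hemisphere_pt n \<sigma> z \<notin> ?C True"
      using that tz by (cases \<sigma>) auto
    ultimately show ?thesis by (auto simp: h_def mc_coord_cell_pt[OF K])
  qed
  have "continuous_map ?X Y h"
  proof (rule pasting_lemma_closed[where I = UNIV and T = "\<lambda>\<sigma>. {0..1} \<times> ?C \<sigma>" and f = ?h])
    fix \<sigma>
    \<comment> \<open>A hemisphere is the image of a compact simplex, hence closed in a Hausdorff
      space.\<close>
    have "compactin ?S (?C \<sigma>)"
      by (rule image_compactin[OF _ continuous_map_hemisphere_pt])
        (simp add: compactin_subtopology compact_cell)
    then have "closedin ?S (?C \<sigma>)"
      by (rule compactin_imp_closedin[OF assms(2)])
    moreover have "closedin (top_of_set {0..1::real}) {0..1}"
      using closedin_topspace[of "top_of_set {0..1::real}"] by simp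
    ultimately show "closedin ?X ({0..1} \<times> ?C \<sigma>)"
      by (simp add: closedin_prod_Times_iff)
    \<comment> \<open>On each cylinder the map factors through time and the globally continuous
      coordinates.\<close>
    have "continuous_map ?X (prod_topology euclidean (powertop_real UNIV)) (\<lambda>x. (fst x, mc_coord (snd x)))"
      using continuous_map_compose[OF continuous_map_snd continuous_map_mc_coord[OF K]]
      by (auto simp: continuous_map_pairwise o_def intro: continuous_map_into_fulltopology continuous_map_fst)
    then have "continuous_map (subtopology ?X ({0..1} \<times> ?C \<sigma>)) (top_of_set ({0..1} \<times> cell n))
        (\<lambda>x. (fst x, mc_coord (snd x)))"
      unfolding continuous_map_in_subtopology
      by (auto simp: euclidean_product_topology mc_coord_cell_pt[OF K] intro: continuous_map_from_subtopology)
    from continuous_map_compose[OF this H]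
    show "continuous_map (subtopology ?X ({0..1} \<times> ?C \<sigma>)) Y (?h \<sigma>)"
      by (simp add: o_def case_prod_unfold)
    show "?h \<sigma> p = ?h \<tau> p" if "p \<in> topspace ?X \<inter> {0..1} \<times> ?C \<sigma> \<inter> {0..1} \<times> ?C \<tau>" for \<tau> p
    proof -
      from that obtain t z w where p: "p = (t, hemisphere_pt n \<sigma> z)" "t \<in> {0..1}" "z \<in> cell n"
        "hemisphere_pt n \<sigma> z = hemisphere_pt n \<tau> w" by auto
      then show ?thesis
        using hemisphere_pt_eqD[OF n p(3,4)] bd'[OF p(2)] by (auto simp: mc_coord_cell_pt[OF K])
    qed
  next
    fix p assume "p \<in> topspace ?X"
    then obtain t \<sigma> z where "p = (t, hemisphere_pt n \<sigma> z)" "t \<in> {0..1}" "z \<in> cell n"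
      by (auto simp: topspace_special_sphere)
    then show "\<exists>\<sigma>. \<sigma> \<in> UNIV \<and> p \<in> {0..1} \<times> ?C \<sigma> \<and> h p = ?h \<sigma> p"
      using h by (intro exI[of _ \<sigma>]) (auto simp: mc_coord_cell_pt[OF K])
  qed auto
  then show thesis using h that by blast
qed

section \<open>Pointed homotopies of spheres as homotopies of pairs\<close>

lemma two_cell_homotopic_cong:
  assumes "two_cell_homotopic n Y a p q p' q'"
    and "\<And>z. z \<in> cell n \<Longrightarrow> p z = u z" "\<And>z. z \<in> cell n \<Longrightarrow> q z = v z"
    and "\<And>z. z \<in> cell n \<Longrightarrow> p' z = u' z" "\<And>z. z \<in> cell n \<Longrightarrow> q' z = v' z"
  shows "two_cell_homotopic n Y a u v u' v'"
  using assms unfolding two_cell_homotopic_def by (simp cong: ball_cong)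

lemma two_cell_homotopic_trans:
  assumes "1 \<le> n" "two_cell_homotopic n Y a p q p' q'" "two_cell_homotopic n Y a p' q' p'' q''"
  shows "two_cell_homotopic n Y a p q p'' q''"
proof -
  have paste: "continuous_map (top_of_set ({0..1} \<times> cell n)) Y
      (\<lambda>x. if fst x \<le> 1/2 then H (2 * fst x, snd x) else H' (2 * fst x - 1, snd x))"
    if "continuous_map (top_of_set ({0..1::real} \<times> cell n)) Y H"
      "continuous_map (top_of_set ({0..1::real} \<times> cell n)) Y H'"
      "\<And>z. z \<in> cell n \<Longrightarrow> H (1, z) = H' (0, z)" for H H'
    by (intro continuous_map_cases_le_on continuous_map_compose_on[OF that(1)] continuous_map_compose_on[OF that(2)])
      (use that(3) in \<open>auto intro!: continuous_pair_intros simp: mult.commute\<close>)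
  obtain H G where HG: "continuous_map (top_of_set ({0..1::real} \<times> cell n)) Y H"
    "continuous_map (top_of_set ({0..1} \<times> cell n)) Y G"
    "\<And>t z. t \<in> {0..1} \<Longrightarrow> z \<in> cell_bd n \<Longrightarrow> H (t, z) = G (t, z)"
    "\<And>t. t \<in> {0..1} \<Longrightarrow> H (t, sphere_base) = a"
    "\<And>z. z \<in> cell n \<Longrightarrow> H (0, z) = p z \<and> G (0, z) = q z \<and> H (1, z) = p' z \<and> G (1, z) = q' z"
    using assms(2) unfolding two_cell_homotopic_def by blast
  obtain H' G' where HG': "continuous_map (top_of_set ({0..1::real} \<times> cell n)) Y H'"
    "continuous_map (top_of_set ({0..1} \<times> cell n)) Y G'"
    "\<And>t z. t \<in> {0..1} \<Longrightarrow> z \<in> cell_bd n \<Longrightarrow> H' (t, z) = G' (t, z)"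
    "\<And>t. t \<in> {0..1} \<Longrightarrow> H' (t, sphere_base) = a"
    "\<And>z. z \<in> cell n \<Longrightarrow> H' (0, z) = p' z \<and> G' (0, z) = q' z \<and> H' (1, z) = p'' z \<and> G' (1, z) = q'' z"
    using assms(3) unfolding two_cell_homotopic_def by blast
  \<comment> \<open>South and north are concatenated with the same change of time, so they still
    agree on the boundary.\<close>
  show ?thesis
    unfolding two_cell_homotopic_def
    by (rule exI, rule exI, intro conjI, rule paste[OF HG(1) HG'(1)], use HG HG' in force,
        rule paste[OF HG(2) HG'(2)], use HG HG' in force)
      (use HG HG' in auto)
qed

text \<open>A homotopy on the round sphere restricts to the two hemispheres through
  \<open>\<psi>\<close>; conversely a pair of homotopies is pasted on the special sphere and pulled
  back along \<open>\<phi>\<close>.\<close>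

lemma homotopic_pointed_sphere_iff:
  assumes n: "1 \<le> n"
    and \<phi>: "homeomorphic_maps (nsphere n) (realization (special_sphere n)) \<phi> \<psi>"
    and base: "\<phi> sphere_base = vertex_pt (special_sphere n) 0"
  shows "homotopic_with (\<lambda>h. h sphere_base = a) (nsphere n) Y f g \<longleftrightarrow>
    two_cell_homotopic n Y a (f \<circ> \<psi> \<circ> hemisphere_pt n False) (f \<circ> \<psi> \<circ> hemisphere_pt n True)
      (g \<circ> \<psi> \<circ> hemisphere_pt n False) (g \<circ> \<psi> \<circ> hemisphere_pt n True)"
    (is "?L \<longleftrightarrow> ?R")
proof -
  let ?S = "realization (special_sphere n)"
  let ?D = "\<lambda>\<sigma>. hemisphere_pt n \<sigma>"
  have K: "multicomplex (special_sphere n)" using n by (rule multicomplex_special_sphere)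
  have c\<phi>: "continuous_map (nsphere n) ?S \<phi>" and c\<psi>: "continuous_map ?S (nsphere n) \<psi>"
    and \<psi>\<phi>: "\<And>x. x \<in> topspace (nsphere n) \<Longrightarrow> \<psi> (\<phi> x) = x"
    using \<phi> by (auto simp: homeomorphic_maps_def)
  have sb: "sphere_base \<in> topspace (nsphere n)"
    unfolding sphere_base_def by (rule in_topspace_nsphere)
  have base': "?D \<sigma> sphere_base = \<phi> sphere_base" for \<sigma>
    by (simp add: base hemisphere_pt_base[OF n])
  then have \<psi>base: "\<psi> (?D \<sigma> sphere_base) = sphere_base" for \<sigma>
    using \<psi>\<phi>[OF sb] by simp
  have L: "?L \<longleftrightarrow> (\<exists>h. continuous_map (prod_topology (top_of_set {0..1::real}) (nsphere n)) Y h \<and>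
      (\<forall>x\<in>topspace (nsphere n). h (0, x) = f x) \<and> (\<forall>x\<in>topspace (nsphere n). h (1, x) = g x) \<and>
      (\<forall>t\<in>{0..1}. h (t, sphere_base) = a))" (is "_ \<longleftrightarrow> ?L'")
    by (rule homotopic_with) (use sb in auto)
  show ?thesis
    unfolding L
  proof
    assume ?L'
    then obtain h where h: "continuous_map (prod_topology (top_of_set {0..1::real}) (nsphere n)) Y h"
      "\<And>x. x \<in> topspace (nsphere n) \<Longrightarrow> h (0, x) = f x" "\<And>x. x \<in> topspace (nsphere n) \<Longrightarrow> h (1, x) = g x"
      "\<And>t. t \<in> {0..1} \<Longrightarrow> h (t, sphere_base) = a" by blast
    let ?H = "\<lambda>\<sigma> x. h (fst x, \<psi> (?D \<sigma> (snd x)))"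
    have D: "continuous_map (top_of_set (cell n)) (nsphere n) (\<lambda>z. \<psi> (?D \<sigma> z))" for \<sigma>
      using continuous_map_compose[OF continuous_map_hemisphere_pt c\<psi>] by (simp add: o_def)
    have cont: "continuous_map (top_of_set ({0..1} \<times> cell n)) Y (?H \<sigma>)" for \<sigma>
    proof -
      have "continuous_map (prod_topology (top_of_set {0..1::real}) (top_of_set (cell n)))
          (prod_topology (top_of_set {0..1}) (nsphere n)) (\<lambda>x. (fst x, \<psi> (?D \<sigma> (snd x))))"
        using continuous_map_compose[OF continuous_map_snd D]
        by (simp add: continuous_map_pairwise o_def continuous_map_fst del: prod_topology_subtopology_eu)
      from continuous_map_compose[OF this h(1)] show ?thesis
        by (simp add: o_def prod_topology_subtopology_eu)
    qed
    have "\<psi> (?D \<sigma> z) \<in> topspace (nsphere n)" if "z \<in> cell n" for \<sigma> z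
      using D that by (auto simp: continuous_map_def)
    then show ?R
      unfolding two_cell_homotopic_def
      by (intro exI[of _ "?H False"] exI[of _ "?H True"])
        (use cont h \<psi>base hemisphere_pt_bd[of _ n False True] in auto)
  next
    assume ?R
    then obtain H G where HG: "continuous_map (top_of_set ({0..1::real} \<times> cell n)) Y H"
      "continuous_map (top_of_set ({0..1} \<times> cell n)) Y G"
      "\<And>t z. t \<in> {0..1} \<Longrightarrow> z \<in> cell_bd n \<Longrightarrow> H (t, z) = G (t, z)"
      "\<And>t. t \<in> {0..1} \<Longrightarrow> H (t, sphere_base) = a"
      "\<And>z. z \<in> cell n \<Longrightarrow> H (0, z) = f (\<psi> (?D False z)) \<and> G (0, z) = f (\<psi> (?D True z)) \<and>
          H (1, z) = g (\<psi> (?D False z)) \<and> G (1, z) = g (\<psi> (?D True z))"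
      unfolding two_cell_homotopic_def by auto
    define F where "F = (\<lambda>\<sigma>. if \<sigma> then G else H)"
    have F: "continuous_map (top_of_set ({0..1} \<times> cell n)) Y (F \<sigma>)" for \<sigma>
      using HG(1,2) by (simp add: F_def)
    have Fends: "F \<sigma> (0, z) = f (\<psi> (?D \<sigma> z))" "F \<sigma> (1, z) = g (\<psi> (?D \<sigma> z))" if "z \<in> cell n" for \<sigma> z
      using HG(5)[OF that] by (cases \<sigma>; simp add: F_def)+
    have "nsphere n homeomorphic_space ?S"
      using \<phi> by (auto simp: homeomorphic_space_def)
    \<comment> \<open>The Hausdorff property required for pasting is carried over from the round
      sphere.\<close>
    moreover have "Hausdorff_space (nsphere n)"
      unfolding nsphere by (simp add: Hausdorff_space_subtopology Hausdorff_space_product_topology)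
    ultimately have "Hausdorff_space ?S"
      by (simp add: homeomorphic_Hausdorff_space)
    then obtain h where h: "continuous_map (prod_topology (top_of_set {0..1}) ?S) Y h"
      "\<And>t z \<sigma>. t \<in> {0..1} \<Longrightarrow> z \<in> cell n \<Longrightarrow> h (t, ?D \<sigma> z) = F \<sigma> (t, z)"
      by (rule continuous_map_special_sphere_paste[where H = F, OF n _ F]) (use HG(3) in \<open>auto simp: F_def\<close>)
    have "continuous_map (prod_topology (top_of_set {0..1::real}) (nsphere n))
        (prod_topology (top_of_set {0..1}) ?S) (\<lambda>x. (fst x, \<phi> (snd x)))"
      using continuous_map_compose[OF continuous_map_snd c\<phi>]
      by (auto simp: continuous_map_pairwise o_def continuous_map_fst)
    from continuous_map_compose[OF this h(1)]
    have c: "continuous_map (prod_topology (top_of_set {0..1::real}) (nsphere n)) Y (\<lambda>x. h (fst x, \<phi> (snd x)))"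
      by (simp add: o_def)
    have ends: "h (0, \<phi> x) = f x \<and> h (1, \<phi> x) = g x" if x: "x \<in> topspace (nsphere n)" for x
    proof -
      have "\<phi> x \<in> topspace ?S" using c\<phi> x by (auto simp: continuous_map_def)
      then obtain \<sigma> z where z: "z \<in> cell n" "\<phi> x = ?D \<sigma> z" by (auto simp: topspace_special_sphere)
      then show ?thesis using h(2)[OF _ z(1), of _ \<sigma>] Fends[OF z(1), of \<sigma>] \<psi>\<phi>[OF x] by simp
    qed
    have "h (t, \<phi> sphere_base) = a" if "t \<in> {0..1}" for t
      using h(2)[OF that sphere_base_cell, of False] HG(4)[OF that] base'[of False] by (simp add: F_def)
    then show ?L'
      by (intro exI[of _ "\<lambda>x. h (fst x, \<phi> (snd x))"]) (use c ends in auto)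
  qed
qed

section \<open>Filling by completeness, and the fibres of \<open>Theta\<close>\<close>

lemma compatible_simplices_sym: "compatible_simplices K \<Delta> \<Delta>' \<Longrightarrow> compatible_simplices K \<Delta>' \<Delta>"
  unfolding compatible_simplices_def by metis

lemma compatible_simplices_fst: "compatible_simplices K \<Delta> \<Delta>' \<Longrightarrow> fst \<Delta> = fst \<Delta>'"
  by (simp add: compatible_simplices_def)

text \<open>The boundary values of \<open>w\<close> come from the embedding of the boundary of
  \<open>\<Delta>\<^sub>0\<close>, so completeness deforms \<open>w\<close> to an embedded simplex.
  Its agreement with \<open>\<Delta>\<^sub>0\<close> on boundary points determines its vertices and
  its proper faces.\<close>

lemma complete_realize_filling:
  fixes K :: "('v, 's) multicomplex_data"
  assumes K: "multicomplex K" and comp: "complete_multicomplex K" and n: "1 \<le> n"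
    and \<Delta>\<^sub>0: "\<Delta>\<^sub>0 \<in> n_simplices K n" and x: "bij_betw x {..n} (fst \<Delta>\<^sub>0)"
    and w: "continuous_map (top_of_set (cell n)) (realization K) w"
    and bd: "\<And>z. z \<in> cell_bd n \<Longrightarrow> w z = char_map K n x \<Delta>\<^sub>0 z"
  obtains \<Delta> where "\<Delta> \<in> compatible_class K n \<Delta>\<^sub>0"
    "homotopic_rel (top_of_set (cell n)) (cell_bd n) (realization K) w (char_map K n x \<Delta>)"
proof -
  interpret multicomplex K by fact
  obtain A \<sigma> where A: "\<Delta>\<^sub>0 = (A, \<sigma>)" "\<sigma> \<in> mc_simps K A" "card A = n + 1"
    using \<Delta>\<^sub>0 by (auto simp: n_simplices_def)
  have im: "x ` {..n} = A" and inj: "inj_on x {..n}" using x A(1) by (auto simp: bij_betw_def)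
  have AV: "A \<subseteq> mc_verts K" using simps_over A(2) by blast
  have S: "multicomplex (std_simplex n)" by (rule multicomplex_std_simplex)
  define G :: "nat set \<Rightarrow> unit \<Rightarrow> 's" where "G = (\<lambda>B _. mc_bdry K A (x ` B) \<sigma>)"
  have xB: "x ` B \<subseteq> A" if "B \<subset> {..n}" for B using that im by auto
  have G: "simplicial_embedding (bd_simplex n) K x G"
    unfolding simplicial_embedding_def simplicial_map_def
    using AV im inj xB bdry_closed[OF A(2)] bdry_comp[OF A(2)]
    by (auto simp: bd_simplex_def G_def image_mono inj_on_def split: if_splits)
  have c: "continuous_map (realization (std_simplex n)) (realization K) (w \<circ> mc_coord)"
    by (rule continuous_map_compose[OF continuous_map_coord_std w])
  have "(w \<circ> mc_coord) (bd_inclusion n p) = realize_map (bd_simplex n) K x G p"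
    if "p \<in> topspace (realization (bd_simplex n))" for p
  proof -
    from that obtain B z where p: "p = cell_pt (bd_simplex n) B () z" and
      B: "B \<noteq> {}" "B \<subset> {..n}" and z: "z \<in> barycentric B"
      by (auto simp: topspace_realization bd_simplex_def split: if_splits)
    have finB: "finite B" using B(2) finite_subset[of B "{..n}"] by auto
    have "(w \<circ> mc_coord) (bd_inclusion n p) = cell_pt K A \<sigma> (affine_ext x {..n} z)"
      using bd[OF face_cell_bd[OF B(2) z]]
      by (simp add: p bd_inclusion_cell_pt[OF n B z] mc_coord_cell_pt[OF S] char_map_def A(1))
    also have "affine_ext x {..n} z = affine_ext x B z"
      by (rule affine_ext_face) (use B z in auto)
    also have "cell_pt K A \<sigma> (affine_ext x B z) = cell_pt K (x ` B) (G B ()) (affine_ext x B z)"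
      unfolding G_def by (rule cell_pt_face[OF A(2) xB[OF B(2)] _ affine_ext_barycentric[OF finB z]]) (use B in auto)
    also have "\<dots> = realize_map (bd_simplex n) K x G p"
      unfolding p
      by (rule realize_map_cell_pt[symmetric, OF multicomplex_bd_simplex[OF n] _ _ z])
        (use G B in \<open>auto simp: simplicial_embedding_def bd_simplex_def\<close>)
    finally show ?thesis .
  qed
  then obtain e E where e: "simplicial_embedding (std_simplex n) K e E"
    "homotopic_rel (realization (std_simplex n)) (bd_points n) (realization K)
       (w \<circ> mc_coord) (realize_map (std_simplex n) K e E)"
    using comp n c G unfolding complete_multicomplex_def by blast
  define \<tau> where "\<tau> = E {..n} ()"
  have sm: "simplicial_map (std_simplex n) K e E" using e(1) by (simp add: simplicial_embedding_def)
  have "() \<in> mc_simps (std_simplex n) {..n}" by (simp add: std_simplex_def)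
  note real = realize_map_cell_pt[OF S sm this]
  have \<tau>e: "\<tau> \<in> mc_simps K (e ` {..n})"
    using sm by (auto simp: simplicial_map_def std_simplex_def \<tau>_def)
  let ?r = "\<lambda>z. cell_pt K (e ` {..n}) \<tau> (affine_ext e {..n} z)"
  have "homotopic_rel (top_of_set (cell n)) (cell_bd n) (realization K)
      (w \<circ> mc_coord \<circ> std_pt n) (realize_map (std_simplex n) K e E \<circ> std_pt n)"
    by (rule homotopic_rel_compose[OF e(2) continuous_map_std_pt]) (simp add: bd_points_eq[OF n])
  then have h: "homotopic_rel (top_of_set (cell n)) (cell_bd n) (realization K) w ?r"
    by (rule homotopic_rel_cong)
      (use cell_bd_subset in \<open>auto simp: mc_coord_cell_pt[OF S] real \<tau>_def\<close>)
  have r_bd: "?r z = cell_pt K A \<sigma> (affine_ext x {..n} z)" if "z \<in> cell_bd n" for z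
    using homotopic_rel_agree[OF h that] bd[OF that] by (simp add: char_map_def A(1))
  \<comment> \<open>Vertices are boundary points because \<open>n \<ge> 1\<close>, so their
    coordinates can be compared.\<close>
  have ex: "e i = x i" if "i \<in> {..n}" for i
  proof -
    have "{i} \<subset> {..n}" using n that by (cases "i = 0") auto
    then have "vertex_coord i \<in> cell_bd n"
      by (rule face_cell_bd) (simp add: vertex_coord_barycentric)
    from cell_pt_eqD(1)[OF K r_bd[OF this]] show ?thesis
      using that by (simp add: affine_ext_vertex_coord vertex_coord_eq_iff)
  qed
  have eim: "e ` {..n} = A" using ex im by force
  have aff: "affine_ext e {..n} = affine_ext x {..n}"
    by (rule affine_ext_cong) (use ex in simp)
  have \<tau>bd: "mc_bdry K A B \<tau> = mc_bdry K A B \<sigma>" if B: "B \<subset> A" "B \<noteq> {}" for B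
  proof -
    define C where "C = {i \<in> {..n}. x i \<in> B}"
    have xC: "x ` C = B" using B im by (auto simp: C_def)
    have C: "C \<subset> {..n}" "C \<noteq> {}" "finite C" using B im xC by (auto simp: C_def)
    \<comment> \<open>The barycenter of the face spanned by the vertices that \<open>x\<close> sends
      into \<open>B\<close>. The support of its image is exactly \<open>B\<close>, so equality of
      the two points is equality of the faces over \<open>B\<close>.\<close>
    define z where "z = (\<lambda>i. if i \<in> C then 1 / real (card C) else 0)"
    have cC: "0 < card C" using C by (simp add: card_gt_0_iff)
    then have "z \<in> barycentric C" by (auto simp: z_def barycentric_def)
    then have z: "z \<in> cell_bd n" by (rule face_cell_bd[OF C(1)])
    have "{i. z i \<noteq> 0} = C" using cC by (auto simp: z_def)
    then have "{v. affine_ext x {..n} z v \<noteq> 0} = B"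
      using support_affine_ext[OF inj, of z] z cell_bd_subset[of n] xC by auto
    then show ?thesis
      using cell_pt_eqD(2)[OF K r_bd[OF z]] by (simp add: eim aff)
  qed
  show thesis
  proof
    show "(A, \<tau>) \<in> compatible_class K n \<Delta>\<^sub>0"
      using \<tau>bd \<tau>e A eim by (auto simp: compatible_class_def n_simplices_def compatible_simplices_def)
    show "homotopic_rel (top_of_set (cell n)) (cell_bd n) (realization K) w (char_map K n x (A, \<tau>))"
      by (rule homotopic_rel_cong[OF h]) (use cell_bd_subset in \<open>auto simp: char_map_def eim aff\<close>)
  qed
qed

theorem theorem3p2p5:
  fixes K :: "('v, 's) multicomplex_data"
    and n :: nat
    and \<Delta>\<^sub>0 :: "'v set \<times> 's"
    and x :: "nat \<Rightarrow> 'v"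
    and \<phi> :: "(nat \<Rightarrow> real) \<Rightarrow> (nat, bool) mc_point"
  assumes "multicomplex K"
    and "complete_multicomplex K"
    and "n \<ge> 1"
    and "\<Delta>\<^sub>0 \<in> n_simplices K n"
    and "bij_betw x {..n} (fst \<Delta>\<^sub>0)"
    and "homeomorphic_map (nsphere n) (realization (special_sphere n)) \<phi>"
    and "\<phi> sphere_base = vertex_pt (special_sphere n) 0"
  shows "Theta K n x \<phi> \<Delta>\<^sub>0 ` compatible_class K n \<Delta>\<^sub>0
           = pi_set n (realization K) (vertex_pt K (x 0)) \<and>
         (\<forall>\<Delta>\<in>compatible_class K n \<Delta>\<^sub>0. \<forall>\<Delta>'\<in>compatible_class K n \<Delta>\<^sub>0.
            Theta K n x \<phi> \<Delta>\<^sub>0 \<Delta> = Theta K n x \<phi> \<Delta>\<^sub>0 \<Delta>' \<longleftrightarrow> homotopic_simplices K n \<Delta> \<Delta>')"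
proof -
  note K = assms(1) and n = assms(3) and \<Delta>\<^sub>0 = assms(4) and x = assms(5)
  let ?Y = "realization K" and ?S = "realization (special_sphere n)" and ?a = "vertex_pt K (x 0)"
  let ?D = "\<lambda>\<sigma>. hemisphere_pt n \<sigma>" and ?c = "char_map K n x"
  obtain \<psi> where \<phi>: "homeomorphic_maps (nsphere n) ?S \<phi> \<psi>"
    using assms(6) by (auto simp: homeomorphic_map_maps)
  then have \<phi>\<psi>: "\<phi> (\<psi> p) = p" if "p \<in> topspace ?S" for p
    using that by (simp add: homeomorphic_maps_def)
  have c\<phi>: "continuous_map (nsphere n) ?S \<phi>" and c\<psi>: "continuous_map ?S (nsphere n) \<psi>"
    using \<phi> by (auto simp: homeomorphic_maps_def)
  note iff = homotopic_pointed_sphere_iff[OF n \<phi> assms(7)]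
  have S: "multicomplex (special_sphere n)" using n by (rule multicomplex_special_sphere)
  have sb: "sphere_base \<in> topspace (nsphere n)"
    unfolding sphere_base_def by (rule in_topspace_nsphere)
  have D_base: "?D \<sigma> sphere_base = \<phi> sphere_base" for \<sigma>
    by (simp add: assms(7) hemisphere_pt_base[OF n])
  have \<psi>base: "\<psi> (?D \<sigma> sphere_base) = sphere_base" for \<sigma>
    using \<phi> sb by (simp add: D_base homeomorphic_maps_def)
  let ?\<Theta> = "\<lambda>\<Delta>. sphere_map K n x \<Delta>\<^sub>0 \<Delta> \<circ> \<phi>"
  let ?P = "\<lambda>h. h sphere_base = ?a"
  have im\<^sub>0: "x ` {..n} = fst \<Delta>\<^sub>0" using x by (simp add: bij_betw_def)
  have cls: "\<Delta> \<in> n_simplices K n" "compatible_simplices K \<Delta>\<^sub>0 \<Delta>" "fst \<Delta> = fst \<Delta>\<^sub>0"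
    if "\<Delta> \<in> compatible_class K n \<Delta>\<^sub>0" for \<Delta>
    using that by (auto simp: compatible_class_def compatible_simplices_fst intro: compatible_simplices_sym)
  \<comment> \<open>Read on the hemispheres, the representing sphere is the pair of characteristic
    maps: \<open>\<Delta>\<^sub>0\<close> in the south and \<open>\<Delta>\<close> in the
    north.\<close>
  have sph: "(?\<Theta> \<Delta> \<circ> \<psi> \<circ> ?D \<sigma>) z = (if \<sigma> then ?c \<Delta> z else ?c \<Delta>\<^sub>0 z)"
    if \<Delta>: "\<Delta> \<in> compatible_class K n \<Delta>\<^sub>0" and z: "z \<in> cell n" for \<Delta> \<sigma> z
  proof -
    have "?D \<sigma> z \<in> topspace ?S" using z by (auto simp: topspace_special_sphere)
    moreover have "\<sigma> \<in> mc_simps (special_sphere n) {..n}" by (cases \<sigma>) (auto simp: special_sphere_def)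
    ultimately show ?thesis
      using realize_map_cell_pt[OF S simplicial_map_sphere_simps[OF K \<Delta>\<^sub>0 cls(1,2)[OF \<Delta>] x] _ z] cls(3)[OF \<Delta>] im\<^sub>0
      by (simp add: \<phi>\<psi> sphere_map_def sphere_simps_def char_map_def)
  qed
  have pointed: "?\<Theta> \<Delta> \<in> pointed_spheres n ?Y ?a" if \<Delta>: "\<Delta> \<in> compatible_class K n \<Delta>\<^sub>0" for \<Delta>
  proof -
    have "continuous_map (nsphere n) ?Y (?\<Theta> \<Delta>)"
      unfolding sphere_map_def
      by (rule continuous_map_compose[OF c\<phi> continuous_map_realize_map[OF S]])
        (rule simplicial_map_sphere_simps[OF K \<Delta>\<^sub>0 cls(1,2)[OF \<Delta>] x])
    moreover have "?\<Theta> \<Delta> sphere_base = ?a"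
      using sph[OF \<Delta> sphere_base_cell, of False] char_map_base[OF K \<Delta>\<^sub>0 im\<^sub>0] by (simp add: \<psi>base)
    ultimately show ?thesis by (simp add: pointed_spheres_def)
  qed
  have class_eq: "sphere_class n ?Y ?a f = sphere_class n ?Y ?a g \<longleftrightarrow> homotopic_with ?P (nsphere n) ?Y f g"
    if "f \<in> pointed_spheres n ?Y ?a" "g \<in> pointed_spheres n ?Y ?a" for f g
  proof -
    have "homotopic_with ?P (nsphere n) ?Y g g" using that by (simp add: pointed_spheres_def)
    then show ?thesis
      unfolding sphere_class_def by (auto intro: homotopic_with_trans homotopic_with_symD)
  qed
  have cu: "continuous_map (top_of_set (cell n)) ?Y (?c \<Delta>\<^sub>0)" and u_base: "?c \<Delta>\<^sub>0 sphere_base = ?a"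
    using continuous_map_char_map[OF \<Delta>\<^sub>0 im\<^sub>0] char_map_base[OF K \<Delta>\<^sub>0 im\<^sub>0] by auto
  have surj: "\<exists>\<Delta>\<in>compatible_class K n \<Delta>\<^sub>0. homotopic_with ?P (nsphere n) ?Y f (?\<Theta> \<Delta>)"
    if f: "f \<in> pointed_spheres n ?Y ?a" for f
  proof -
    have cD: "continuous_map (top_of_set (cell n)) ?Y (f \<circ> \<psi> \<circ> ?D \<sigma>)" for \<sigma>
      using f c\<psi> by (auto simp: pointed_spheres_def intro: continuous_map_compose continuous_map_hemisphere_pt)
    obtain w where w: "continuous_map (top_of_set (cell n)) ?Y w"
      "\<And>z. z \<in> cell_bd n \<Longrightarrow> w z = ?c \<Delta>\<^sub>0 z"
      "two_cell_homotopic n ?Y ?a (f \<circ> \<psi> \<circ> ?D False) (f \<circ> \<psi> \<circ> ?D True) (?c \<Delta>\<^sub>0) w"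
      by (rule two_cell_homotopic_south[OF cD[of False] cD[of True] cu])
        (use f hemisphere_pt_bd[of _ n False True] in \<open>auto simp: \<psi>base u_base pointed_spheres_def\<close>)
    obtain \<Delta> where \<Delta>: "\<Delta> \<in> compatible_class K n \<Delta>\<^sub>0"
      "homotopic_rel (top_of_set (cell n)) (cell_bd n) ?Y w (?c \<Delta>)"
      using complete_realize_filling[OF K assms(2) n \<Delta>\<^sub>0 x w(1,2)] by blast
    \<comment> \<open>The first homotopy brings the south to \<open>\<Delta>\<^sub>0\<close>; the
      second keeps it there and deforms the north \<open>w\<close> to
      \<open>\<Delta>\<close>.\<close>
    have "two_cell_homotopic n ?Y ?a (f \<circ> \<psi> \<circ> ?D False) (f \<circ> \<psi> \<circ> ?D True) (?c \<Delta>\<^sub>0) (?c \<Delta>)"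
      using two_cell_homotopic_trans[OF n w(3) rel_imp_two_cell_homotopic[OF cu u_base \<Delta>(2) w(2)]] .
    then have "homotopic_with ?P (nsphere n) ?Y f (?\<Theta> \<Delta>)"
      unfolding iff by (rule two_cell_homotopic_cong) (simp_all only: sph[OF \<Delta>(1)] if_True if_False)
    then show ?thesis using \<Delta>(1) by blast
  qed
  show ?thesis
  proof (intro conjI ballI)
    show "Theta K n x \<phi> \<Delta>\<^sub>0 ` compatible_class K n \<Delta>\<^sub>0 = pi_set n ?Y ?a"
    proof
      show "Theta K n x \<phi> \<Delta>\<^sub>0 ` compatible_class K n \<Delta>\<^sub>0 \<subseteq> pi_set n ?Y ?a"
        using pointed by (auto simp: Theta_def pi_set_def)
      show "pi_set n ?Y ?a \<subseteq> Theta K n x \<phi> \<Delta>\<^sub>0 ` compatible_class K n \<Delta>\<^sub>0"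
        unfolding pi_set_def Theta_def using surj pointed class_eq by fast
    qed
    fix \<Delta> \<Delta>' assume \<Delta>: "\<Delta> \<in> compatible_class K n \<Delta>\<^sub>0" and \<Delta>': "\<Delta>' \<in> compatible_class K n \<Delta>\<^sub>0"
    \<comment> \<open>Both have the proper faces of \<open>\<Delta>\<^sub>0\<close>.\<close>
    have compat: "compatible_simplices K \<Delta> \<Delta>'"
      using cls(2)[OF \<Delta>] cls(2)[OF \<Delta>'] unfolding compatible_simplices_def by metis
    have "Theta K n x \<phi> \<Delta>\<^sub>0 \<Delta> = Theta K n x \<phi> \<Delta>\<^sub>0 \<Delta>' \<longleftrightarrow> homotopic_with ?P (nsphere n) ?Y (?\<Theta> \<Delta>) (?\<Theta> \<Delta>')"
      unfolding Theta_def by (rule class_eq[OF pointed[OF \<Delta>] pointed[OF \<Delta>']])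
    also have "\<dots> \<longleftrightarrow> two_cell_homotopic n ?Y ?a (?c \<Delta>\<^sub>0) (?c \<Delta>) (?c \<Delta>\<^sub>0) (?c \<Delta>')"
      unfolding iff
      by (intro iffI; erule two_cell_homotopic_cong)
        (simp_all only: sph[OF \<Delta>] sph[OF \<Delta>'] if_True if_False)
    \<comment> \<open>The south is the characteristic map of \<open>\<Delta>\<^sub>0\<close> at both
      ends, so only the north is left to compare, relative to the boundary.\<close>
    also have "\<dots> \<longleftrightarrow> homotopic_rel (top_of_set (cell n)) (cell_bd n) ?Y (?c \<Delta>) (?c \<Delta>')"
      using two_cell_homotopic_imp_rel rel_imp_two_cell_homotopic[OF cu u_base]
        char_map_compatible[OF \<Delta>\<^sub>0 cls(1,2)[OF \<Delta>] x] by metis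
    also have "\<dots> \<longleftrightarrow> homotopic_simplices K n \<Delta> \<Delta>'"
      using homotopic_simplices_iff[OF K n cls(1)[OF \<Delta>] cls(1)[OF \<Delta>'] compat] x cls(3)[OF \<Delta>] by simp
    finally show "Theta K n x \<phi> \<Delta>\<^sub>0 \<Delta> = Theta K n x \<phi> \<Delta>\<^sub>0 \<Delta>' \<longleftrightarrow> homotopic_simplices K n \<Delta> \<Delta>'" .
  qed
qed

end
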